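(* Let $R$ be a nilpotent based ring, let $M$ be an indecomposable based $R$-module, and let $V\in M$ be a basic element. Then $\mathrm{FPdim}(M)/\mathrm{FPdim}(V)^2\in\mathbb{Z}$. In particular, $\mathrm{FPdim}(R_{ad})/\mathrm{FPdim}(X)^2\in\mathbb{Z}$ for every basic $X$ in $R$.
   Context: A based ring is a pair $(R,B)$ where $R$ is a ring with identity, free of finite rank as a $\mathbb{Z}$-module, and $B=\{X_i\}_{i\in\mathcal{I}}$ is a $\mathbb{Z}$-basis of $R$ (its elements are called basic) such that $X_iX_j=\sum_{k}c_{ij}^kX_k$ with all $c_{ij}^k$ non-negative integers, the identity $1$ belongs to $B$ (all based rings are unital), and there is an involution $i\mapsto i^*$ of $\mathcal{I}$ whose induced map $X=\sum a_iX_i\mapsto X^*=\sum a_iX_{i^*}$ satisfies $(XY,Z)=(X,ZY^* )=(Y,X^*Z)$ for all $X,Y,Z\in R$, where $(\sum a_iX_i,\sum b_iX_i)=\sum a_ib_i$. A based subring is a subring spanned by a subset of $B$ that is itself a based ring with that basis. $R_{ad}$ is the minimal based subring of $R$ containing $X_iX_i^*$ for all $i$. Put $R^{(0)}=R$ and $R^{(n)}=(R^{(n-1)})_{ad}$ for $n\ge1$; $R$ is nilpotent if $R^{(n)}=\mathbb{Z}1$ for some $n$. A based (left) $R$-module is a left $R$-module $M$, free of finite rank over $\mathbb{Z}$, with a fixed basis $\{V_j\}_{j\in\mathcal{J}}$ (its elements are called basic) such that $X_iV_j=\sum_k d_{ij}^kV_k$ with $d_{ij}^k$ non-negative integers and $d_{ij}^k=d_{i^*k}^j$.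 Based submodules are submodules spanned by subsets of the basis; $M$ is indecomposable if it is nonzero and is not a direct sum of two nonzero based submodules. Frobenius-Perron dimensions: $\mathrm{FPdim}:R\to\mathbb{R}$ is the unique ring homomorphism taking positive values on basic elements; the Frobenius-Perron dimension of a based ring is the sum of the squares of the dimensions of its basic elements. For indecomposable $M$ there is a unique up to positive scalar vector $Q=\sum_j\mu_jV_j\in M\otimes_{\mathbb{Z}}\mathbb{R}$ with all $\mu_j>0$ which is a common eigenvector of left multiplication by all $X\in R$ (with eigenvalue $\mathrm{FPdim}(X)$). One sets $\mathrm{FPdim}(V_j)=\mu_j$ and $\mathrm{FPdim}(M)=\sum_j\mu_j^2$; the ratios $\mathrm{FPdim}(M)/\mathrm{FPdim}(V_j)^2$ do not depend on the choice of $Q$. *)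

theory Defs
  imports Complex_Main "HOL-Library.FuncSet"
begin

section \<open>Abelian groups as modules over the integers\<close>

definition zmult :: "int \<Rightarrow> 'g::ab_group_add \<Rightarrow> 'g"
  where "zmult k x = (\<Sum>i<nat k. x) - (\<Sum>i<nat (- k). x)"

lemma zmult_of_nat: "zmult (int n) x = (\<Sum>i<n. x)"
  by (simp add: zmult_def)

lemma zmult_diff: "zmult (int m - int n) x = (\<Sum>i<m. x) - (\<Sum>i<n. x)"
proof -
  have add: "(\<Sum>i<a + b. x) = (\<Sum>i<a. x) + (\<Sum>i<b. x)" for a b :: nat
    by (induction b) (simp_all add: algebra_simps)
  show ?thesis
  proof (cases "n \<le> m")
    case True
    then obtain d where "m = n + d" using le_Suc_ex by blast
    then show ?thesis by (simp add: zmult_def add)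
  next
    case False
    then obtain d where "n = m + d" using le_Suc_ex nat_le_linear by blast
    then show ?thesis by (simp add: zmult_def add)
  qed
qed

interpretation zm: module "zmult :: int \<Rightarrow> 'g::ab_group_add \<Rightarrow> 'g"
proof
  fix a b :: int and x y :: 'g
  obtain m n where a: "a = int m - int n" by (metis int_diff_cases)
  obtain p q where b: "b = int p - int q" by (metis int_diff_cases)
  have add: "(\<Sum>i<i + j. z) = (\<Sum>i<i. z) + (\<Sum>i<j. z)" for i j :: nat and z :: 'g
    by (induction j) (simp_all add: algebra_simps)
  have mul: "(\<Sum>i<i * j. z) = (\<Sum>i<i. \<Sum>i<j. z)" for i j :: nat and z :: 'g
    by (induction i) (simp_all add: add algebra_simps)
  have ab: "a + b = int (m + p) - int (n + q)" using a b by simp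
  have axb: "a * b = int (m * p + n * q) - int (m * q + n * p)"
    by (simp only: a b of_nat_add of_nat_mult) (simp only: algebra_simps)
  show "zmult a (x + y) = zmult a x + zmult a y"
    by (simp only: a zmult_diff) (simp add: sum.distrib algebra_simps)
  show "zmult (a + b) x = zmult a x + zmult b x"
    by (simp only: ab zmult_diff add) (simp add: a b zmult_diff algebra_simps)
  show "zmult a (zmult b x) = zmult (a * b) x"
    by (simp only: axb) (simp only: a b zmult_diff add mul sum_subtractf, simp add: algebra_simps)
  show "zmult 1 x = x"
    by (simp add: zmult_def)
qed

lemma zmult_eq_of_int: "zmult k (x :: 'a::ring_1) = of_int k * x"
proof -
  obtain m n where k: "k = int m - int n" by (metis int_diff_cases)
  show ?thesis
    by (simp only: k zmult_diff) (simp add: left_diff_distrib)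
qed

text \<open>If \<open>B\<close> is a \<open>\<int>\<close>-basis of its span, \<open>zcoeff B x b\<close> is the coefficient of \<open>x\<close> at \<open>b\<close>.\<close>

abbreviation zspan :: "'g::ab_group_add set \<Rightarrow> 'g set"
  where "zspan \<equiv> module.span zmult"

abbreviation zindependent :: "'g::ab_group_add set \<Rightarrow> bool"
  where "zindependent \<equiv> module.independent zmult"

abbreviation zcoeff :: "'g::ab_group_add set \<Rightarrow> 'g \<Rightarrow> 'g \<Rightarrow> int"
  where "zcoeff \<equiv> module.representation zmult"


section \<open>Based rings\<close>

text \<open>
  A based ring lives inside an ambient unital ring, the type \<open>'a\<close>, whose identity it contains;
  the basis indexes itself, so the involution of the index set is a map on \<open>B\<close>.
\<close>

definition basis_form :: "'a::ring_1 set \<Rightarrow> 'a \<Rightarrow> 'a \<Rightarrow> int"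
  where "basis_form B x y = (\<Sum>b\<in>B. zcoeff B x b * zcoeff B y b)"

definition star_extend :: "'a::ring_1 set \<Rightarrow> ('a \<Rightarrow> 'a) \<Rightarrow> 'a \<Rightarrow> 'a"
  where "star_extend B s x = (\<Sum>b\<in>B. zmult (zcoeff B x b) (s b))"

definition based_involution :: "'a::ring_1 set \<Rightarrow> 'a set \<Rightarrow> ('a \<Rightarrow> 'a) \<Rightarrow> bool"
  where "based_involution R B s \<longleftrightarrow>
    (\<forall>b\<in>B. s b \<in> B \<and> s (s b) = b) \<and>
    (\<forall>x\<in>R. \<forall>y\<in>R. \<forall>z\<in>R.
       basis_form B (x * y) z = basis_form B x (z * star_extend B s y) \<and>
       basis_form B (x * y) z = basis_form B y (star_extend B s x * z))"

locale based_ring =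
  fixes R B :: "'a::ring_1 set"
  assumes finite_basis: "finite B"
    and independent_basis: "zindependent B"
    and span_basis: "R = zspan B"
    and one_basic: "1 \<in> B"
    and mult_closed: "\<And>x y. x \<in> R \<Longrightarrow> y \<in> R \<Longrightarrow> x * y \<in> R"
    and structure_nonneg: "\<And>x y z. x \<in> B \<Longrightarrow> y \<in> B \<Longrightarrow> z \<in> B \<Longrightarrow> 0 \<le> zcoeff B (x * y) z"
    and involution: "\<exists>s. based_involution R B s"

text \<open>
  The involution of a based ring is unique on \<open>B\<close>: \<open>b\<^sup>*\<close> is the only basic \<open>c\<close> for which
  the coefficient of \<open>1\<close> in \<open>b * c\<close> is nonzero.  So the choice is immaterial for \<open>b \<in> B\<close>.
\<close>

definition basic_star :: "'a::ring_1 set \<Rightarrow> 'a set \<Rightarrow> 'a \<Rightarrow> 'a"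
  where "basic_star R B = (SOME s. based_involution R B s)"

definition based_subring :: "'a::ring_1 set \<Rightarrow> 'a set \<Rightarrow> bool"
  where "based_subring B S \<longleftrightarrow> (\<exists>C\<subseteq>B. based_ring S C)"

definition adjoint_subring :: "'a::ring_1 set \<Rightarrow> 'a set \<Rightarrow> 'a set"
  where "adjoint_subring R B = based_subring B hull {x * basic_star R B x | x. x \<in> B}"

abbreviation adjoint_basis :: "'a::ring_1 set \<Rightarrow> 'a set \<Rightarrow> 'a set"
  where "adjoint_basis R B \<equiv> B \<inter> adjoint_subring R B"

text \<open>The pair consisting of \<open>R\<^sup>(\<^sup>n\<^sup>)\<close> and its basis.\<close>

fun iterated_adjoint :: "'a::ring_1 set \<Rightarrow> 'a set \<Rightarrow> nat \<Rightarrow> 'a set \<times> 'a set"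
  where
    "iterated_adjoint R B 0 = (R, B)"
  | "iterated_adjoint R B (Suc n) =
      (let (S, C) = iterated_adjoint R B n in (adjoint_subring S C, adjoint_basis S C))"

definition nilpotent_based_ring :: "'a::ring_1 set \<Rightarrow> 'a set \<Rightarrow> bool"
  where "nilpotent_based_ring R B \<longleftrightarrow>
    based_ring R B \<and> (\<exists>n. fst (iterated_adjoint R B n) = zspan {1})"


section \<open>Based modules\<close>

locale based_module = based_ring R B
  for R B :: "'a::ring_1 set" +
  fixes act :: "'a \<Rightarrow> 'm::ab_group_add \<Rightarrow> 'm"
    and M V :: "'m set"
  assumes finite_module_basis: "finite V"
    and independent_module_basis: "zindependent V"
    and span_module_basis: "M = zspan V"
    and act_closed: "\<And>r m. r \<in> R \<Longrightarrow> m \<in> M \<Longrightarrow> act r m \<in> M"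
    and act_add_right: "\<And>r m n. r \<in> R \<Longrightarrow> m \<in> M \<Longrightarrow> n \<in> M \<Longrightarrow> act r (m + n) = act r m + act r n"
    and act_add_left: "\<And>r s m. r \<in> R \<Longrightarrow> s \<in> R \<Longrightarrow> m \<in> M \<Longrightarrow> act (r + s) m = act r m + act s m"
    and act_mult: "\<And>r s m. r \<in> R \<Longrightarrow> s \<in> R \<Longrightarrow> m \<in> M \<Longrightarrow> act (r * s) m = act r (act s m)"
    and act_one: "\<And>m. m \<in> M \<Longrightarrow> act 1 m = m"
    and act_nonneg: "\<And>x v w. x \<in> B \<Longrightarrow> v \<in> V \<Longrightarrow> w \<in> V \<Longrightarrow> 0 \<le> zcoeff V (act x v) w"
    and act_star: "\<And>x v w. x \<in> B \<Longrightarrow> v \<in> V \<Longrightarrow> w \<in> V \<Longrightarrow>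
      zcoeff V (act x v) w = zcoeff V (act (basic_star R B x) w) v"

definition based_submodule ::
    "'a::ring_1 set \<Rightarrow> ('a \<Rightarrow> 'm::ab_group_add \<Rightarrow> 'm) \<Rightarrow> 'm set \<Rightarrow> 'm set \<Rightarrow> bool"
  where "based_submodule R act V N \<longleftrightarrow>
    (\<exists>W\<subseteq>V. N = zspan W) \<and> (\<forall>r\<in>R. \<forall>m\<in>N. act r m \<in> N)"

definition indecomposable_based_module ::
    "'a::ring_1 set \<Rightarrow> 'a set \<Rightarrow> ('a \<Rightarrow> 'm::ab_group_add \<Rightarrow> 'm) \<Rightarrow> 'm set \<Rightarrow> 'm set \<Rightarrow> bool"
  where "indecomposable_based_module R B act M V \<longleftrightarrow>
    based_module R B act M V \<and> M \<noteq> {0} \<and>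
    \<not> (\<exists>N P. based_submodule R act V N \<and> based_submodule R act V P \<and>
          N \<noteq> {0} \<and> P \<noteq> {0} \<and> N \<inter> P = {0} \<and> M = {n + p | n p. n \<in> N \<and> p \<in> P})"


section \<open>Frobenius-Perron dimensions\<close>

text \<open>
  The homomorphism \<open>R \<rightarrow> \<real>\<close> is unique only as a function on \<open>R\<close>, hence the restriction to
  \<^const>\<open>extensional\<close> functions.
\<close>

definition FPdim :: "'a::ring_1 set \<Rightarrow> 'a set \<Rightarrow> 'a \<Rightarrow> real"
  where "FPdim R B = (THE f. f \<in> extensional R \<and> f 1 = 1 \<and>
    (\<forall>x\<in>R. \<forall>y\<in>R. f (x + y) = f x + f y \<and> f (x * y) = f x * f y) \<and>
    (\<forall>b\<in>B. 0 < f b))"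

definition FPdim_ring :: "'a::ring_1 set \<Rightarrow> 'a set \<Rightarrow> real"
  where "FPdim_ring R B = (\<Sum>b\<in>B. (FPdim R B b)\<^sup>2)"

text \<open>
  An element \<open>\<Sum>j. \<mu> j V\<^sub>j\<close> of \<open>M \<otimes> \<real>\<close> is given by its coordinate function \<open>\<mu>\<close>; the sum below
  is the coordinate at \<open>w\<close> of its product with \<open>x\<close>.
\<close>

definition FP_eigenvector ::
    "'a::ring_1 set \<Rightarrow> 'a set \<Rightarrow> ('a \<Rightarrow> 'm::ab_group_add \<Rightarrow> 'm) \<Rightarrow> 'm set \<Rightarrow> ('m \<Rightarrow> real) \<Rightarrow> bool"
  where "FP_eigenvector R B act V \<mu> \<longleftrightarrow>
    (\<forall>v\<in>V. 0 < \<mu> v) \<and>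
    (\<forall>x\<in>R. \<forall>w\<in>V. (\<Sum>v\<in>V. of_int (zcoeff V (act x v) w) * \<mu> v) = FPdim R B x * \<mu> w)"

text \<open>
  For indecomposable \<open>M\<close> the eigenvector is unique up to a positive scalar; an arbitrary one is
  fixed here.
\<close>

definition FPdim_basic ::
    "'a::ring_1 set \<Rightarrow> 'a set \<Rightarrow> ('a \<Rightarrow> 'm::ab_group_add \<Rightarrow> 'm) \<Rightarrow> 'm set \<Rightarrow> 'm \<Rightarrow> real"
  where "FPdim_basic R B act V = (SOME \<mu>. FP_eigenvector R B act V \<mu>)"

definition FPdim_module ::
    "'a::ring_1 set \<Rightarrow> 'a set \<Rightarrow> ('a \<Rightarrow> 'm::ab_group_add \<Rightarrow> 'm) \<Rightarrow> 'm set \<Rightarrow> real"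
  where "FPdim_module R B act V = (\<Sum>v\<in>V. (FPdim_basic R B act V v)\<^sup>2)"

end

theory Submission
  imports Defs "HOL-Analysis.Function_Topology"
begin

text \<open>
  The proof is an induction along the chain \<open>R \<supseteq> R\<^sub>a\<^sub>d \<supseteq> \<dots>\<close>.  Write \<open>M\<close>, as a module over
  \<open>R\<^sub>a\<^sub>d\<close>, as a direct sum of indecomposable components.  The key point is that all components have
  the same dimension when they are measured with one common eigenvector \<open>Q\<close>: then \<open>FPdim M\<close> is the
  number of components times the dimension of the one that contains \<open>V\<close>, and that dimension, divided
  by the square of the dimension of \<open>V\<close>, is an integer by the induction hypothesis for \<open>R\<^sub>a\<^sub>d\<close>.

  Two facts give the key point.  The adjoint subring is normal in the sense that \<open>x R\<^sub>a\<^sub>d x\<^sup>*\<close> is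
  contained in \<open>R\<^sub>a\<^sub>d\<close> (\<open>adj_normal\<close>), and therefore a basic \<open>x\<close> maps each component \<open>C\<close> into a
  single component \<open>D\<close>.  So \<open>x Q\<^sub>C = FPdim(x) Q\<^sub>D\<close> and \<open>x\<^sup>* Q\<^sub>D = FPdim(x) Q\<^sub>C\<close>, and since
  \<open>x\<^sup>*\<close> is adjoint to \<open>x\<close>, the vectors \<open>Q\<^sub>C\<close> and \<open>Q\<^sub>D\<close> have the same length
  (\<open>adj_orbit_norm_eq\<close>).  Indecomposability of \<open>M\<close> over \<open>R\<close> connects any two components in this way.

  For the second claim take \<open>R\<close> itself as a left \<open>R\<^sub>a\<^sub>d\<close>-module and look at the component of \<open>X\<close>.
  Right multiplication by \<open>X\<close> and \<open>X\<^sup>*\<close> exchanges it with \<open>R\<^sub>a\<^sub>d\<close>, so the same argument shows that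
  its dimension is that of \<open>R\<^sub>a\<^sub>d\<close> (\<open>adj_coset_norm_eq\<close>).

  All this takes place at the level of structure constants.  Since \<open>FPdim\<close> is defined by a
  description and the dimensions of a module by a choice, it must also be shown that \<open>FPdim\<close> exists
  and is unique and that a common positive eigenvector exists.  Perron-Frobenius theory for a single
  symmetric positive matrix, right multiplication by the sum of the basis, gives the former
  (\<open>character_exists\<close>, \<open>character_unique\<close>); the sum of the basis weighted with dimensions, applied
  to any basic element of the module, gives the latter (\<open>eigenvector_exists\<close>).
\<close>

section \<open>Perron-Frobenius theory for symmetric positive matrices\<close>

lemma compact_box:
  fixes S :: "'a \<Rightarrow> real set"
  assumes "\<And>b. compact (S b)"
  shows "compact {x. \<forall>b. x b \<in> S b}"
proof -
  have "compactin (product_topology (\<lambda>_. euclidean) UNIV) (Pi\<^sub>E UNIV S)"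
    using assms by (simp add: compactin_PiE compactin_euclidean_iff)
  moreover have "Pi\<^sub>E UNIV S = {x. \<forall>b. x b \<in> S b}" by auto
  ultimately show ?thesis
    by (simp add: euclidean_product_topology compactin_euclidean_iff)
qed

text \<open>
  First-order optimality: a perturbation whose linear gain is dominated by a quadratic cost for
  every small step has no linear gain.
\<close>

lemma nonpos_if_quadratic_bound:
  fixes a k :: real
  assumes "\<And>t. 0 < t \<Longrightarrow> a * t \<le> k * t\<^sup>2"
  shows "a \<le> 0"
proof (rule ccontr)
  assume "\<not> a \<le> 0"
  define t where "t = a / (2 * (\<bar>k\<bar> + 1))"
  have t: "0 < t" using \<open>\<not> a \<le> 0\<close> by (simp add: t_def)
  have "a * t \<le> (k * t) * t" using assms[OF t] by (simp add: power2_eq_square mult.assoc)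
  then have "a \<le> k * t" using t by simp
  also have "\<dots> \<le> (\<bar>k\<bar> + 1) * t" using t by (intro mult_right_mono) auto
  also have "\<dots> = a / 2"
    using add_pos_nonneg[of 1 "\<bar>k\<bar>"] by (simp add: t_def field_simps)
  finally show False using \<open>\<not> a \<le> 0\<close> by simp
qed

text \<open>
  For a symmetric positive matrix the Perron eigenvector comes from the variational
  principle.  Maximise the quadratic form \<open>q\<close> over the nonnegative unit vectors, which form a
  compact set.  Moving the maximiser \<open>u\<close> in the direction of a basis vector gives
  \<open>(N u) b \<le> l * u b\<close> with \<open>l = q u\<close>, while the average of the differences with weights
  \<open>u b\<close> is zero; hence each of them vanishes where \<open>u\<close> is nonzero.  Positivity of \<open>N\<close> makes
  \<open>N u\<close>, and with it \<open>u\<close>, positive everywhere.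
\<close>

lemma perron_symmetric:
  fixes N :: "'a \<Rightarrow> 'a \<Rightarrow> real"
  assumes fin: "finite B" and ne: "B \<noteq> {}"
    and sym: "\<And>x y. x \<in> B \<Longrightarrow> y \<in> B \<Longrightarrow> N x y = N y x"
    and pos: "\<And>x y. x \<in> B \<Longrightarrow> y \<in> B \<Longrightarrow> 0 < N x y"
  shows "\<exists>l u. (\<forall>x\<in>B. 0 < u x) \<and> (\<forall>x\<in>B. (\<Sum>y\<in>B. N x y * u y) = l * u x)"
proof -
  define q where "q x = (\<Sum>a\<in>B. \<Sum>b\<in>B. N a b * (x a * x b))" for x :: "'a \<Rightarrow> real"
  define n where "n x = (\<Sum>a\<in>B. (x a)\<^sup>2)" for x :: "'a \<Rightarrow> real"
  define K where "K = {x. \<forall>b. x b \<in> (if b \<in> B then {0..1} else {0::real})} \<inter> {x. n x = 1}"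
  have "closed {x. n x = 1}"
    unfolding n_def by (intro closed_Collect_eq continuous_intros continuous_on_product_coordinates)
  then have "compact K"
    unfolding K_def by (intro compact_Int_closed compact_box) auto
  moreover have "K \<noteq> {}"
  proof -
    obtain b where b: "b \<in> B" using ne by blast
    have "(\<Sum>a\<in>B. (if a = b then 1 else 0 :: real)\<^sup>2) = (\<Sum>a\<in>B. if a = b then 1 else 0)"
      by (intro sum.cong) auto
    then have "(\<lambda>a. if a = b then 1 else 0) \<in> K"
      using b fin by (auto simp: K_def n_def)
    then show ?thesis by blast
  qed
  moreover have "continuous_on K q"
    unfolding q_def
    by (rule continuous_on_subset[of UNIV])
       (intro continuous_intros continuous_on_product_coordinates, simp)
  ultimately obtain u where u: "u \<in> K" and umax: "\<And>x. x \<in> K \<Longrightarrow> q x \<le> q u"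
    using continuous_attains_sup[of K q] by blast
  define l where "l = q u"
  have u0: "0 \<le> u b" for b using u by (auto simp: K_def split: if_splits dest!: spec[of _ b])
  have n1: "n u = 1" using u by (simp add: K_def)
  \<comment> \<open>both sides are homogeneous of degree two, so the bound on the unit vectors extends\<close>
  have rayleigh: "q x \<le> l * n x" if x: "\<And>b. b \<in> B \<Longrightarrow> 0 \<le> x b" for x
  proof (cases "n x = 0")
    case True
    then have "\<forall>b\<in>B. x b = 0" using fin by (simp add: n_def sum_nonneg_eq_0_iff)
    then show ?thesis using True by (simp add: q_def)
  next
    case False
    then have np: "0 < n x" by (simp add: n_def sum_nonneg order_less_le)
    define y where "y b = (if b \<in> B then x b / sqrt (n x) else 0)" for b
    have ny: "n y = n x / (sqrt (n x))\<^sup>2"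
      by (simp add: n_def y_def power_divide sum_divide_distrib)
    then have ny: "n y = 1" using np by simp
    have "y b \<le> 1" if "b \<in> B" for b
    proof -
      have "(y b)\<^sup>2 \<le> n y" unfolding n_def by (rule member_le_sum) (use fin that in auto)
      then show ?thesis using ny power2_le_imp_le[of "y b" 1] by simp
    qed
    moreover have "0 \<le> y b" for b using x np by (auto simp: y_def)
    moreover have "y b = 0" if "b \<notin> B" for b using that by (simp add: y_def)
    ultimately have "y \<in> K" using ny by (auto simp: K_def)
    then have "q y \<le> l" using umax l_def by simp
    moreover have "q y = q x / (sqrt (n x))\<^sup>2"
      by (simp add: q_def y_def power2_eq_square sum_divide_distrib)
    ultimately show ?thesis using np by (simp add: field_simps)
  qed
  define v where "v b = (\<Sum>y\<in>B. N b y * u y)" for b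
  have qu: "q u = (\<Sum>b\<in>B. v b * u b)"
    by (simp add: q_def v_def sum_distrib_right sum_distrib_left mult_ac)
  have le: "v b \<le> l * u b" if b: "b \<in> B" for b
  proof -
    have "(2 * (v b - l * u b)) * t \<le> (l - N b b) * t\<^sup>2" if t: "0 < t" for t
    proof -
      define x where "x a = u a + (if a = b then t else 0)" for a
      have x0: "0 \<le> x a" for a using u0 t by (simp add: x_def)
      have "n x = (\<Sum>a\<in>B. (u a)\<^sup>2 + (if a = b then 2 * u b * t + t\<^sup>2 else 0))"
        unfolding n_def by (intro sum.cong) (auto simp: x_def power2_eq_square algebra_simps)
      then have nx: "n x = n u + 2 * u b * t + t\<^sup>2"
        using b fin by (simp add: n_def sum.distrib)
      have "q x = (\<Sum>a\<in>B. (\<Sum>a'\<in>B. N a a' * (u a * u a')) + N a b * u a * t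
          + (if a = b then (\<Sum>a'\<in>B. N b a' * u a') * t + N b b * t * t else 0))"
        unfolding q_def
      proof (intro sum.cong refl)
        fix a assume "a \<in> B"
        have "(\<Sum>a'\<in>B. N a a' * (x a * x a'))
          = (\<Sum>a'\<in>B. N a a' * (x a * u a') + (if a' = b then N a b * (x a * t) else 0))"
          by (intro sum.cong) (auto simp: x_def algebra_simps)
        also have "\<dots> = (\<Sum>a'\<in>B. N a a' * (x a * u a')) + N a b * (x a * t)"
          using b fin by (simp add: sum.distrib)
        also have "\<dots> = (\<Sum>a'\<in>B. N a a' * (u a * u a')) + N a b * u a * t
          + (if a = b then (\<Sum>a'\<in>B. N b a' * u a') * t + N b b * t * t else 0)"
          by (auto simp: x_def algebra_simps sum.distrib sum_distrib_left)
        finally show "(\<Sum>a'\<in>B. N a a' * (x a * x a')) = \<dots>" .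
      qed
      also have "\<dots> = q u + (\<Sum>a\<in>B. N a b * u a) * t + v b * t + N b b * t * t"
        using b fin by (simp add: q_def v_def sum.distrib sum_distrib_right)
      also have "(\<Sum>a\<in>B. N a b * u a) = v b"
        unfolding v_def using b by (intro sum.cong) (auto simp: sym)
      finally have qx: "q x = q u + 2 * v b * t + N b b * t\<^sup>2"
        by (simp add: power2_eq_square algebra_simps)
      show ?thesis using rayleigh[of x] x0 unfolding nx qx n1 l_def[symmetric]
        by (simp add: algebra_simps)
    qed
    then have "2 * (v b - l * u b) \<le> 0" by (rule nonpos_if_quadratic_bound)
    then show ?thesis by simp
  qed
  \<comment> \<open>complementary slackness: nonnegative terms with sum zero\<close>
  have "(\<Sum>b\<in>B. (l * u b - v b) * u b) = l * n u - q u"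
    by (simp add: qu n_def algebra_simps power2_eq_square sum_subtractf sum_distrib_left)
  then have "(\<Sum>b\<in>B. (l * u b - v b) * u b) = 0" by (simp add: n1 l_def)
  then have comp: "(l * u b - v b) * u b = 0" if "b \<in> B" for b
    using that fin le u0 by (subst (asm) sum_nonneg_eq_0_iff) auto
  have "\<not> (\<forall>b\<in>B. u b = 0)"
  proof
    assume "\<forall>b\<in>B. u b = 0"
    then have "n u = 0" by (simp add: n_def)
    then show False using n1 by simp
  qed
  then obtain b0 where b0: "b0 \<in> B" "u b0 \<noteq> 0" by blast
  have vpos: "0 < v b" if "b \<in> B" for b
    unfolding v_def
    by (rule sum_pos2[OF fin b0(1)])
       (use u0[of b0] b0 pos[OF that] u0 in \<open>auto simp: less_le\<close>)
  have upos: "0 < u b" if "b \<in> B" for b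
    using le[OF that] vpos[OF that] u0[of b] by (cases "u b = 0") auto
  have "(\<Sum>y\<in>B. N b y * u y) = l * u b" if "b \<in> B" for b
    using comp[OF that] upos[OF that] by (simp add: v_def)
  then show ?thesis using upos by blast
qed

text \<open>
  The eigenvalue of a positive eigenvector is geometrically simple: subtract the largest multiple
  \<open>k\<close> of \<open>u\<close> that leaves \<open>w - k u\<close> nonnegative.  The difference has a zero entry, and there the
  eigenvalue equation says that a combination of its entries with positive coefficients vanishes.
\<close>

lemma perron_simple:
  fixes N :: "'a \<Rightarrow> 'a \<Rightarrow> real"
  assumes fin: "finite B" and ne: "B \<noteq> {}"
    and pos: "\<And>x y. x \<in> B \<Longrightarrow> y \<in> B \<Longrightarrow> 0 < N x y"
    and u: "\<And>x. x \<in> B \<Longrightarrow> 0 < u x"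
    and eu: "\<And>x. x \<in> B \<Longrightarrow> (\<Sum>y\<in>B. N x y * u y) = l * u x"
    and ew: "\<And>x. x \<in> B \<Longrightarrow> (\<Sum>y\<in>B. N x y * w y) = l * w x"
  shows "\<exists>k. \<forall>x\<in>B. w x = k * u x"
proof -
  define k where "k = Min ((\<lambda>x. w x / u x) ` B)"
  have "k \<in> (\<lambda>x. w x / u x) ` B" unfolding k_def using fin ne by (intro Min_in) auto
  then obtain a where a: "a \<in> B" "k = w a / u a" by blast
  have ge: "0 \<le> w x - k * u x" if "x \<in> B" for x
  proof -
    have "k \<le> w x / u x" unfolding k_def using fin that by (intro Min_le) auto
    then show ?thesis using u[OF that] by (simp add: field_simps)
  qed
  have "(\<Sum>y\<in>B. N a y * (w y - k * u y)) = l * (w a - k * u a)"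
  proof -
    have "(\<Sum>y\<in>B. N a y * (w y - k * u y)) = (\<Sum>y\<in>B. N a y * w y) - k * (\<Sum>y\<in>B. N a y * u y)"
      by (simp add: algebra_simps sum_subtractf sum_distrib_left)
    then show ?thesis using eu[OF a(1)] ew[OF a(1)] by (simp only: right_diff_distrib) simp
  qed
  also have "\<dots> = 0" using a u[OF a(1)] by simp
  finally have "\<forall>y\<in>B. N a y * (w y - k * u y) = 0"
    using fin ge pos[OF a(1)] by (subst (asm) sum_nonneg_eq_0_iff) (auto simp: less_imp_le)
  then have "w x = k * u x" if "x \<in> B" for x using pos[OF a(1) that] that by force
  then show ?thesis by blast
qed

section \<open>Structure constants and the adjoint subring\<close>

text \<open>
  A based ring is recorded here by its structure constants \<open>c\<close> and its involution \<open>s\<close> alone.  In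
  this form a based subring is a subset of \<open>B\<close> with the same \<open>c\<close> and \<open>s\<close>, so that passing to the
  adjoint subring, again and again, changes nothing but the index set.  The constants are real
  numbers because they are multiplied with dimensions throughout.
\<close>

locale fusion_ring =
  fixes B :: "'a set" and e :: 'a and s :: "'a \<Rightarrow> 'a" and c :: "'a \<Rightarrow> 'a \<Rightarrow> 'a \<Rightarrow> real"
  assumes finite_B: "finite B"
    and unit_in: "e \<in> B"
    and star_in: "x \<in> B \<Longrightarrow> s x \<in> B"
    and star_star: "x \<in> B \<Longrightarrow> s (s x) = x"
    and nonneg: "x \<in> B \<Longrightarrow> y \<in> B \<Longrightarrow> z \<in> B \<Longrightarrow> 0 \<le> c x y z"
    and unit_left: "y \<in> B \<Longrightarrow> z \<in> B \<Longrightarrow> c e y z = (if y = z then 1 else 0)"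
    and assoc: "x \<in> B \<Longrightarrow> y \<in> B \<Longrightarrow> w \<in> B \<Longrightarrow> t \<in> B \<Longrightarrow>
      (\<Sum>z\<in>B. c x y z * c z w t) = (\<Sum>z\<in>B. c y w z * c x z t)"
    and frobenius_right: "x \<in> B \<Longrightarrow> y \<in> B \<Longrightarrow> z \<in> B \<Longrightarrow> c x y z = c z (s y) x"
    and frobenius_left: "x \<in> B \<Longrightarrow> y \<in> B \<Longrightarrow> z \<in> B \<Longrightarrow> c x y z = c (s x) z y"

text \<open>
  The basis of the adjoint subring, generated from below.  It is closed
  under the involution because the generating products \<open>x x\<^sup>*\<close> are self-adjoint.
\<close>

inductive_set adjoint_closure :: "'a set \<Rightarrow> ('a \<Rightarrow> 'a) \<Rightarrow> ('a \<Rightarrow> 'a \<Rightarrow> 'a \<Rightarrow> real) \<Rightarrow> 'a set"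
  for B s c where
    square: "x \<in> B \<Longrightarrow> z \<in> B \<Longrightarrow> c x (s x) z \<noteq> 0 \<Longrightarrow> z \<in> adjoint_closure B s c"
  | product: "x \<in> adjoint_closure B s c \<Longrightarrow> y \<in> adjoint_closure B s c \<Longrightarrow> z \<in> B \<Longrightarrow>
      c x y z \<noteq> 0 \<Longrightarrow> z \<in> adjoint_closure B s c"

lemma nonneg_sum_nonzero_iff:
  fixes f :: "'a \<Rightarrow> real"
  assumes "finite B" "\<And>x. x \<in> B \<Longrightarrow> 0 \<le> f x"
  shows "(\<Sum>x\<in>B. f x) \<noteq> 0 \<longleftrightarrow> (\<exists>x\<in>B. f x \<noteq> 0)"
  using assms by (simp add: sum_nonneg_eq_0_iff)

text \<open>
  Nonnegativity excludes cancellation, so identities between structure constants become statements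
  about supports: \<open>c x y z \<noteq> 0\<close> is read as \<open>z \<in> x y\<close>, a multivalued multiplication.
\<close>

lemma product_sum_nonzero_iff:
  fixes f :: "'a \<Rightarrow> real"
  assumes "finite B" "\<And>x. x \<in> B \<Longrightarrow> 0 \<le> f x" "\<And>x. x \<in> B \<Longrightarrow> 0 \<le> g x"
  shows "(\<Sum>x\<in>B. f x * g x) \<noteq> 0 \<longleftrightarrow> (\<exists>x\<in>B. f x \<noteq> 0 \<and> g x \<noteq> 0)"
  using nonneg_sum_nonzero_iff[of B "\<lambda>x. f x * g x"] assms by simp

context fusion_ring
begin

lemma contains_assoc:
  assumes "x \<in> B" "y \<in> B" "w \<in> B" "t \<in> B"
  shows "(\<exists>z\<in>B. c x y z \<noteq> 0 \<and> c z w t \<noteq> 0) \<longleftrightarrow> (\<exists>z\<in>B. c y w z \<noteq> 0 \<and> c x z t \<noteq> 0)"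
proof -
  have "(\<exists>z\<in>B. c x y z \<noteq> 0 \<and> c z w t \<noteq> 0) \<longleftrightarrow> (\<Sum>z\<in>B. c x y z * c z w t) \<noteq> 0"
    using assms by (intro product_sum_nonzero_iff[symmetric] finite_B nonneg)
  also have "\<dots> \<longleftrightarrow> (\<Sum>z\<in>B. c y w z * c x z t) \<noteq> 0"
    using assoc[OF assms] by simp
  also have "\<dots> \<longleftrightarrow> (\<exists>z\<in>B. c y w z \<noteq> 0 \<and> c x z t \<noteq> 0)"
    using assms by (intro product_sum_nonzero_iff finite_B nonneg)
  finally show ?thesis .
qed

lemma assoc_rightD:
  assumes "c x y z \<noteq> 0" "c z w t \<noteq> 0" "x \<in> B" "y \<in> B" "w \<in> B" "t \<in> B" "z \<in> B"
  obtains v where "v \<in> B" "c y w v \<noteq> 0" "c x v t \<noteq> 0"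
  using contains_assoc[of x y w t] assms by blast

lemma assoc_leftD:
  assumes "c y w z \<noteq> 0" "c x z t \<noteq> 0" "x \<in> B" "y \<in> B" "w \<in> B" "t \<in> B" "z \<in> B"
  obtains v where "v \<in> B" "c x y v \<noteq> 0" "c v w t \<noteq> 0"
  using contains_assoc[of x y w t] assms by blast

lemma star_product:
  assumes "x \<in> B" "y \<in> B" "z \<in> B"
  shows "c x y z = c (s y) (s x) (s z)"
proof -
  have "c x y z = c (s x) z y" using assms by (rule frobenius_left)
  also have "\<dots> = c y (s z) (s x)" using assms by (intro frobenius_right star_in)
  also have "\<dots> = c (s y) (s x) (s z)" using assms by (intro frobenius_left star_in)
  finally show ?thesis .
qed

lemma unit_right:
  assumes "x \<in> B" "y \<in> B"
  shows "c x e y = (if x = y then 1 else 0)"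
proof -
  have "c x e y = c (s x) y e" using assms by (intro frobenius_left) (auto simp: unit_in)
  also have "\<dots> = c e (s y) (s x)" using assms by (intro frobenius_right) (auto simp: unit_in star_in)
  also have "\<dots> = (if s y = s x then 1 else 0)" using assms by (simp add: unit_left star_in)
  also have "s y = s x \<longleftrightarrow> x = y" using star_star[of x] star_star[of y] assms by auto
  finally show ?thesis .
qed

lemma square_contains_unit: "x \<in> B \<Longrightarrow> c x (s x) e \<noteq> 0"
  using frobenius_right[of e x x] unit_left[of x x] unit_in by simp

text \<open>
  Every \<open>y\<close> lies in \<open>x (x\<^sup>* y)\<close>, since \<open>1 \<in> x x\<^sup>*\<close>.
\<close>

lemma quotient_contains:
  assumes "x \<in> B" "y \<in> B"
  obtains z where "z \<in> B" "c x z y \<noteq> 0"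
proof -
  have "\<exists>v\<in>B. c x v y \<noteq> 0"
    using assoc_rightD[of x "s x" e y y] assms square_contains_unit[of x] unit_left[of y y] unit_in star_in
    by auto
  then show ?thesis using that by blast
qed

lemma restrict_fusion_ring:
  assumes sub: "A \<subseteq> B" and "e \<in> A" and star: "\<And>x. x \<in> A \<Longrightarrow> s x \<in> A"
    and closed: "\<And>x y z. x \<in> A \<Longrightarrow> y \<in> A \<Longrightarrow> z \<in> B \<Longrightarrow> c x y z \<noteq> 0 \<Longrightarrow> z \<in> A"
  shows "fusion_ring A e s c"
proof -
  have zero: "c x y z = 0" if "x \<in> A" "y \<in> A" "z \<in> B - A" for x y z
    using closed[OF that(1,2), of z] that(3) by blast
  have in_B: "x \<in> B" if "x \<in> A" for x using sub that by blast
  have assoc_A: "(\<Sum>z\<in>A. c x y z * c z w t) = (\<Sum>z\<in>A. c y w z * c x z t)"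
    if "x \<in> A" "y \<in> A" "w \<in> A" "t \<in> A" for x y w t
  proof -
    have "(\<Sum>z\<in>A. c x y z * c z w t) = (\<Sum>z\<in>B. c x y z * c z w t)"
      by (rule sum.mono_neutral_left[OF finite_B sub]) (simp add: zero that)
    also have "\<dots> = (\<Sum>z\<in>B. c y w z * c x z t)"
      by (intro assoc in_B that)
    also have "\<dots> = (\<Sum>z\<in>A. c y w z * c x z t)"
      by (rule sum.mono_neutral_right[OF finite_B sub]) (simp add: zero that)
    finally show ?thesis .
  qed
  show ?thesis
  proof
    show "finite A" using sub finite_B by (rule finite_subset)
  qed (use \<open>e \<in> A\<close> star assoc_A in
        \<open>blast intro: in_B star_star nonneg frobenius_left frobenius_right unit_left\<close>)+
qed

abbreviation adj :: "'a set" where "adj \<equiv> adjoint_closure B s c"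

lemma adj_subset: "adj \<subseteq> B"
  by (auto elim: adjoint_closure.cases)

lemma adj_in: "x \<in> adj \<Longrightarrow> x \<in> B"
  using adj_subset by blast

lemma unit_in_adj: "e \<in> adj"
  using square_contains_unit[OF unit_in] unit_in by (blast intro: adjoint_closure.square)

lemma star_in_adj: "x \<in> adj \<Longrightarrow> s x \<in> adj"
proof (induction rule: adjoint_closure.induct)
  case (square x z)
  then have "c x (s x) (s z) \<noteq> 0" using star_product[of x "s x" z] by (simp add: star_in star_star)
  then show ?case using square star_in by (blast intro: adjoint_closure.square)
next
  case (product x y z)
  then have "c (s y) (s x) (s z) \<noteq> 0" using star_product[of x y z] adj_in by auto
  then show ?case using product star_in by (blast intro: adjoint_closure.product)
qed

lemma fusion_ring_adj: "fusion_ring adj e s c"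
  by (rule restrict_fusion_ring)
     (auto intro: adj_in unit_in_adj star_in_adj adjoint_closure.product)

text \<open>
  Normality of the adjoint subring: \<open>x a x\<^sup>*\<close> stays inside it.  For \<open>a \<in> z z\<^sup>*\<close> an element of
  \<open>x z z\<^sup>* x\<^sup>*\<close> lies in some \<open>p q\<close> with \<open>p\<close> and \<open>q\<^sup>*\<close> both in \<open>x z\<close>.  Then
  \<open>q\<^sup>* \<in> x z \<subseteq> x x\<^sup>* p\<close>, whence \<open>q \<in> p\<^sup>* b\<^sup>*\<close> with \<open>b \<in> x x\<^sup>*\<close>, and \<open>p q \<subseteq> (p p\<^sup>*) b\<^sup>*\<close> is
  made of adjoint elements.  For a product \<open>a b\<close> insert \<open>1 \<in> x\<^sup>* x\<close>:
  \<open>x a b x\<^sup>* \<subseteq> (x a x\<^sup>*) (x b x\<^sup>*)\<close>.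
\<close>

lemma adj_normal:
  assumes "a \<in> adj" "x \<in> B" "u \<in> B" "t \<in> B" "c x a u \<noteq> 0" "c u (s x) t \<noteq> 0"
  shows "t \<in> adj"
  using assms
proof (induction arbitrary: u t rule: adjoint_closure.induct)
  case (square z a)
  note B = square(1,2,4,5,6) star_in[OF square(1)] star_in[OF square(4)]
  obtain p where p: "p \<in> B" "c x z p \<noteq> 0" "c p (s z) u \<noteq> 0"
    using assoc_leftD[OF square(3,7)] B by blast
  obtain q where q: "q \<in> B" "c (s z) (s x) q \<noteq> 0" "c p q t \<noteq> 0"
    using assoc_rightD[OF p(3) square(8)] B p by blast
  have "c x z (s q) \<noteq> 0"
    using star_product[of "s z" "s x" q] q B by (simp add: star_star)
  moreover have "c (s x) p z \<noteq> 0" using frobenius_left[of x z p] p B by simp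
  ultimately obtain b where b: "b \<in> B" "c x (s x) b \<noteq> 0" "c b p (s q) \<noteq> 0"
    using assoc_leftD[of "s x" p z x "s q"] B p(1) q(1) star_in by blast
  have "c (s p) (s b) q \<noteq> 0"
    using star_product[of b p "s q"] b p q star_in by (simp add: star_star)
  then obtain r where r: "r \<in> B" "c p (s p) r \<noteq> 0" "c r (s b) t \<noteq> 0"
    using assoc_leftD[of "s p" "s b" q p t] q p b B star_in by blast
  have "r \<in> adj" using r p by (blast intro: adjoint_closure.square)
  moreover have "b \<in> adj" using b B by (blast intro: adjoint_closure.square)
  ultimately show ?case using r B star_in_adj by (blast intro: adjoint_closure.product)
next
  case (product a b g)
  note B = product.hyps(3) product.prems(1-3) adj_in[OF product.hyps(1)] adj_in[OF product.hyps(2)] star_in[OF product.prems(1)]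
  obtain p where p: "p \<in> B" "c x a p \<noteq> 0" "c p b u \<noteq> 0"
    using assoc_leftD[OF product.hyps(4) product.prems(4)] B by blast
  obtain q where q: "q \<in> B" "c b (s x) q \<noteq> 0" "c p q t \<noteq> 0"
    using assoc_rightD[OF p(3) product.prems(5)] B p by blast
  have "c (s x) x e \<noteq> 0" using square_contains_unit[of "s x"] B by (simp add: star_star)
  moreover have "c e q q \<noteq> 0" using q by (simp add: unit_left)
  ultimately obtain r where r: "r \<in> B" "c x q r \<noteq> 0" "c (s x) r q \<noteq> 0"
    using assoc_rightD[of "s x" x e q q] B q unit_in by blast
  obtain m where m: "m \<in> B" "c p (s x) m \<noteq> 0" "c m r t \<noteq> 0"
    using assoc_leftD[OF r(3) q(3)] B p q r by blast
  have "m \<in> adj" using product.IH(1)[of p m] p m B by blast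
  moreover obtain u' where "u' \<in> B" "c x b u' \<noteq> 0" "c u' (s x) r \<noteq> 0"
    using assoc_leftD[OF q(2) r(2)] B q r by blast
  then have "r \<in> adj" using product.IH(2)[of u' r] r B by blast
  ultimately show ?case using m B by (blast intro: adjoint_closure.product)
qed

end

section \<open>Characters\<close>

context fusion_ring
begin

lemma sum_star: "(\<Sum>x\<in>B. h (s x)) = (\<Sum>x\<in>B. h x)"
  by (rule sum.reindex_bij_witness[of _ s s]) (simp_all add: star_in star_star)

text \<open>
  The coordinate form of a ring homomorphism to the reals that is positive on the basis.
\<close>

definition character :: "('a \<Rightarrow> real) \<Rightarrow> bool"
  where "character f \<longleftrightarrow> (\<forall>x\<in>B. 0 < f x) \<and> (\<forall>x\<in>B. \<forall>y\<in>B. (\<Sum>z\<in>B. c x y z * f z) = f x * f y)"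

lemma character_pos: "character f \<Longrightarrow> x \<in> B \<Longrightarrow> 0 < f x"
  by (simp add: character_def)

lemma character_mult: "character f \<Longrightarrow> x \<in> B \<Longrightarrow> y \<in> B \<Longrightarrow> (\<Sum>z\<in>B. c x y z * f z) = f x * f y"
  by (simp add: character_def)

text \<open>
  The matrix of right multiplication by the sum of all basic elements.  It is symmetric because the
  involution permutes the basis, it is positive by \<open>quotient_contains\<close>, and it commutes with left
  multiplications; these three properties produce the character.
\<close>

definition total_mult :: "'a \<Rightarrow> 'a \<Rightarrow> real"
  where "total_mult y z = (\<Sum>x\<in>B. c y x z)"

lemma total_mult_pos:
  assumes "y \<in> B" "z \<in> B"
  shows "0 < total_mult y z"
proof -
  obtain x where "x \<in> B" "c y x z \<noteq> 0" using quotient_contains[OF assms] by blast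
  then show ?thesis unfolding total_mult_def
    using nonneg assms by (intro sum_pos2[OF finite_B]) (auto simp: less_le)
qed

lemma total_mult_sym:
  assumes "y \<in> B" "z \<in> B"
  shows "total_mult y z = total_mult z y"
proof -
  have "total_mult y z = (\<Sum>x\<in>B. c z (s x) y)"
    unfolding total_mult_def using assms by (intro sum.cong refl frobenius_right)
  then show ?thesis by (simp add: total_mult_def sum_star[of "\<lambda>x. c z x y"])
qed

text \<open>
  Regard the Perron eigenvector \<open>u\<close> as a linear functional, with \<open>u (y S) = l * u y\<close> for the sum \<open>S\<close>
  of the basis.  For each \<open>x\<close> the functional \<open>y \<mapsto> u (x y)\<close> satisfies the same equation by
  associativity, so by simplicity of the eigenvalue it is a multiple of \<open>u\<close>.  Evaluation at the unit
  identifies the factor as \<open>u x / u e\<close>, and \<open>x \<mapsto> u x / u e\<close> is multiplicative.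
\<close>

lemma character_exists: "\<exists>f. character f"
proof -
  have ne: "B \<noteq> {}" using unit_in by blast
  obtain l u where u: "\<And>x. x \<in> B \<Longrightarrow> 0 < u x"
    and eu: "\<And>y. y \<in> B \<Longrightarrow> (\<Sum>z\<in>B. total_mult y z * u z) = l * u y"
    using perron_symmetric[where N=total_mult, OF finite_B ne total_mult_sym total_mult_pos] by auto
  have mult: "(\<Sum>z\<in>B. c x y z * u z) = (u x / u e) * u y" if xy: "x \<in> B" "y \<in> B" for x y
  proof -
    have "(\<Sum>z\<in>B. total_mult y z * (\<Sum>t\<in>B. c x z t * u t)) = l * (\<Sum>t\<in>B. c x y t * u t)"
      if y: "y \<in> B" for y
    proof -
      have "(\<Sum>z\<in>B. total_mult y z * (\<Sum>t\<in>B. c x z t * u t))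
        = (\<Sum>z\<in>B. \<Sum>w\<in>B. \<Sum>t\<in>B. c y w z * c x z t * u t)"
        by (simp only: total_mult_def sum_product mult.assoc)
      also have "\<dots> = (\<Sum>w\<in>B. \<Sum>z\<in>B. \<Sum>t\<in>B. c y w z * c x z t * u t)"
        by (rule sum.swap)
      also have "\<dots> = (\<Sum>w\<in>B. \<Sum>t\<in>B. \<Sum>z\<in>B. c y w z * c x z t * u t)"
        by (intro sum.cong refl sum.swap)
      also have "\<dots> = (\<Sum>w\<in>B. \<Sum>t\<in>B. (\<Sum>z\<in>B. c x y z * c z w t) * u t)"
        using xy(1) y by (intro sum.cong refl) (simp add: sum_distrib_right[symmetric] assoc)
      also have "\<dots> = (\<Sum>w\<in>B. \<Sum>t\<in>B. \<Sum>z\<in>B. c x y z * c z w t * u t)"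
        by (simp add: sum_distrib_right)
      also have "\<dots> = (\<Sum>w\<in>B. \<Sum>z\<in>B. \<Sum>t\<in>B. c x y z * c z w t * u t)"
        by (intro sum.cong refl sum.swap)
      also have "\<dots> = (\<Sum>z\<in>B. \<Sum>w\<in>B. \<Sum>t\<in>B. c x y z * c z w t * u t)"
        by (rule sum.swap)
      also have "\<dots> = (\<Sum>z\<in>B. \<Sum>t\<in>B. \<Sum>w\<in>B. c x y z * c z w t * u t)"
        by (intro sum.cong refl sum.swap)
      also have "\<dots> = (\<Sum>z\<in>B. c x y z * (\<Sum>t\<in>B. total_mult z t * u t))"
        by (simp only: total_mult_def sum_distrib_left sum_distrib_right mult.assoc)
      also have "\<dots> = l * (\<Sum>z\<in>B. c x y z * u z)"
        by (simp add: eu) (simp add: sum_distrib_left mult_ac)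
      finally show ?thesis .
    qed
    then have "\<exists>k. \<forall>y\<in>B. (\<Sum>t\<in>B. c x y t * u t) = k * u y"
      by (intro perron_simple[where N=total_mult, OF finite_B ne total_mult_pos u eu])
    then obtain k where k: "\<And>y. y \<in> B \<Longrightarrow> (\<Sum>t\<in>B. c x y t * u t) = k * u y" by blast
    have "(\<Sum>t\<in>B. c x e t * u t) = (\<Sum>t\<in>B. if x = t then u t else 0)"
      using xy by (intro sum.cong) (auto simp: unit_right)
    then have "u x = k * u e" using k[OF unit_in] xy finite_B by simp
    then show ?thesis using k xy u[OF unit_in] by simp
  qed
  have "character (\<lambda>x. u x / u e)"
    using mult u unit_in by (simp add: character_def sum_divide_distrib[symmetric])
  then show ?thesis by blast
qed

lemma character_unit:
  assumes f: "character f"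
  shows "f e = 1"
proof -
  have "f e * f e = (\<Sum>z\<in>B. if e = z then f z else 0)"
    unfolding character_mult[OF f unit_in unit_in, symmetric]
    using unit_in by (intro sum.cong) (auto simp: unit_left)
  then show ?thesis using character_pos[OF f unit_in] unit_in finite_B by simp
qed

text \<open>
  A character is an eigenvector of the symmetric positive matrix \<^const>\<open>total_mult\<close>, with its
  sum over the basis as eigenvalue.  Two positive vectors are not orthogonal, so by symmetry the
  eigenvalues of two characters agree; simplicity makes them proportional, and both are \<open>1\<close> at the
  unit.
\<close>

lemma character_unique:
  assumes f: "character f" and g: "character g" and x: "x \<in> B"
  shows "f x = g x"
proof -
  have ne: "B \<noteq> {}" using unit_in by blast
  have eigen: "(\<Sum>z\<in>B. total_mult y z * h z) = (\<Sum>x\<in>B. h x) * h y"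
    if h: "character h" and y: "y \<in> B" for h y
  proof -
    have "(\<Sum>z\<in>B. total_mult y z * h z) = (\<Sum>x\<in>B. \<Sum>z\<in>B. c y x z * h z)"
      unfolding total_mult_def sum_distrib_right by (rule sum.swap)
    also have "\<dots> = (\<Sum>x\<in>B. h x) * h y"
      by (simp add: character_mult[OF h y] sum_distrib_left[symmetric])
    finally show ?thesis .
  qed
  have "(\<Sum>x\<in>B. f x) * (\<Sum>y\<in>B. g y * f y) = (\<Sum>y\<in>B. ((\<Sum>x\<in>B. f x) * f y) * g y)"
    unfolding sum_distrib_left[of "\<Sum>x\<in>B. f x"] by (simp only: mult_ac)
  also have "\<dots> = (\<Sum>y\<in>B. \<Sum>z\<in>B. total_mult y z * f z * g y)"
    by (intro sum.cong refl) (simp add: eigen[OF f] flip: sum_distrib_right)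
  also have "\<dots> = (\<Sum>z\<in>B. \<Sum>y\<in>B. total_mult y z * f z * g y)" by (rule sum.swap)
  also have "\<dots> = (\<Sum>z\<in>B. \<Sum>y\<in>B. total_mult z y * g y * f z)"
    by (intro sum.cong refl) (simp add: total_mult_sym)
  also have "\<dots> = (\<Sum>z\<in>B. ((\<Sum>x\<in>B. g x) * g z) * f z)"
    by (intro sum.cong refl) (simp add: eigen[OF g] flip: sum_distrib_right)
  also have "\<dots> = (\<Sum>x\<in>B. g x) * (\<Sum>y\<in>B. g y * f y)"
    unfolding sum_distrib_left[of "\<Sum>x\<in>B. g x"] by (simp only: mult_ac)
  finally have "(\<Sum>x\<in>B. f x) * (\<Sum>y\<in>B. g y * f y) = (\<Sum>x\<in>B. g x) * (\<Sum>y\<in>B. g y * f y)" .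
  moreover have "0 < (\<Sum>y\<in>B. g y * f y)"
    using finite_B ne character_pos[OF f] character_pos[OF g] by (intro sum_pos) auto
  ultimately have sum_eq: "(\<Sum>x\<in>B. f x) = (\<Sum>x\<in>B. g x)" by simp
  have "\<exists>k. \<forall>y\<in>B. f y = k * g y"
    by (rule perron_simple[where N=total_mult, OF finite_B ne total_mult_pos character_pos[OF g] eigen[OF g]])
       (simp_all add: eigen[OF f] sum_eq)
  then obtain k where k: "\<And>y. y \<in> B \<Longrightarrow> f y = k * g y" by blast
  show ?thesis using k[OF x] k[OF unit_in] character_unit[OF f] character_unit[OF g] by simp
qed

text \<open>
  The involution reverses products, but the reals are commutative; so composing a character with it
  gives a character again, and uniqueness applies.
\<close>

lemma character_star:
  assumes f: "character f" and x: "x \<in> B"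
  shows "f (s x) = f x"
proof -
  have "character (\<lambda>x. f (s x))"
    unfolding character_def
  proof (intro conjI ballI)
    fix x y assume B: "x \<in> B" "y \<in> B"
    have "(\<Sum>z\<in>B. c x y z * f (s z)) = (\<Sum>z\<in>B. c (s y) (s x) (s z) * f (s z))"
      using B by (intro sum.cong refl) (simp add: star_product[symmetric])
    also have "\<dots> = f (s y) * f (s x)"
      unfolding sum_star[of "\<lambda>z. c (s y) (s x) z * f z"] using B f by (intro character_mult star_in)
    finally show "(\<Sum>z\<in>B. c x y z * f (s z)) = f (s x) * f (s y)" by simp
  qed (simp add: character_pos f star_in)
  then show ?thesis using f x by (rule character_unique)
qed

lemma character_adj:
  assumes "character f"
  shows "fusion_ring.character adj c f"
proof -
  interpret Adj: fusion_ring adj e s c by (rule fusion_ring_adj)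
  have "(\<Sum>z\<in>adj. c x y z * f z) = (\<Sum>z\<in>B. c x y z * f z)" if "x \<in> adj" "y \<in> adj" for x y
    by (rule sum.mono_neutral_left[OF finite_B adj_subset])
       (use that in \<open>auto dest: adjoint_closure.product\<close>)
  then show ?thesis
    using assms by (simp add: Adj.character_def character_def adj_in)
qed

end

section \<open>Modules and their components over the adjoint subring\<close>

text \<open>
  A based module in coordinates, \<open>d x v w\<close> being the coefficient of \<open>w\<close> in \<open>x v\<close>.
\<close>

locale fusion_module = fusion_ring B e s c
  for B :: "'a set" and e s c +
  fixes V :: "'m set" and d :: "'a \<Rightarrow> 'm \<Rightarrow> 'm \<Rightarrow> real"
  assumes finite_V: "finite V"
    and act_nonneg: "x \<in> B \<Longrightarrow> v \<in> V \<Longrightarrow> w \<in> V \<Longrightarrow> 0 \<le> d x v w"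
    and act_unit: "v \<in> V \<Longrightarrow> w \<in> V \<Longrightarrow> d e v w = (if v = w then 1 else 0)"
    and act_assoc: "x \<in> B \<Longrightarrow> y \<in> B \<Longrightarrow> v \<in> V \<Longrightarrow> w \<in> V \<Longrightarrow>
      (\<Sum>z\<in>B. c x y z * d z v w) = (\<Sum>u\<in>V. d y v u * d x u w)"
    and act_star: "x \<in> B \<Longrightarrow> v \<in> V \<Longrightarrow> w \<in> V \<Longrightarrow> d x v w = d (s x) w v"
begin

definition orbit :: "'m \<Rightarrow> 'm set"
  where "orbit v = {w \<in> V. \<exists>x\<in>B. d x v w \<noteq> 0}"

definition eigenvector :: "('a \<Rightarrow> real) \<Rightarrow> ('m \<Rightarrow> real) \<Rightarrow> bool"
  where "eigenvector f \<mu> \<longleftrightarrow> (\<forall>v\<in>V. 0 < \<mu> v) \<and>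
    (\<forall>x\<in>B. \<forall>w\<in>V. (\<Sum>v\<in>V. d x v w * \<mu> v) = f x * \<mu> w)"

lemma act_contains:
  assumes "x \<in> B" "y \<in> B" "v \<in> V" "w \<in> V"
  shows "(\<exists>z\<in>B. c x y z \<noteq> 0 \<and> d z v w \<noteq> 0) \<longleftrightarrow> (\<exists>u\<in>V. d y v u \<noteq> 0 \<and> d x u w \<noteq> 0)"
proof -
  have "(\<exists>z\<in>B. c x y z \<noteq> 0 \<and> d z v w \<noteq> 0) \<longleftrightarrow> (\<Sum>z\<in>B. c x y z * d z v w) \<noteq> 0"
    using assms by (intro product_sum_nonzero_iff[symmetric] finite_B nonneg act_nonneg)
  also have "\<dots> \<longleftrightarrow> (\<Sum>u\<in>V. d y v u * d x u w) \<noteq> 0"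
    using act_assoc[OF assms] by simp
  also have "\<dots> \<longleftrightarrow> (\<exists>u\<in>V. d y v u \<noteq> 0 \<and> d x u w \<noteq> 0)"
    using assms by (intro product_sum_nonzero_iff finite_V act_nonneg)
  finally show ?thesis .
qed

lemma act_compose:
  assumes "d y v u \<noteq> 0" "d x u w \<noteq> 0" "x \<in> B" "y \<in> B" "v \<in> V" "u \<in> V" "w \<in> V"
  obtains z where "z \<in> B" "c x y z \<noteq> 0" "d z v w \<noteq> 0"
  using act_contains[of x y v w] assms by blast

text \<open>
  Orbits are equivalence classes: reflexive by the unit, symmetric by the involution, transitive
  because supports compose without cancellation.  They carry the indecomposable summands.
\<close>

lemma orbit_subset: "orbit v \<subseteq> V"
  by (auto simp: orbit_def)

lemma orbit_refl: "v \<in> V \<Longrightarrow> v \<in> orbit v"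
  using act_unit[of v v] unit_in by (auto simp: orbit_def intro!: bexI[of _ e])

lemma orbit_sym: "v \<in> V \<Longrightarrow> w \<in> orbit v \<Longrightarrow> v \<in> orbit w"
  using act_star[of _ v w] star_in by (fastforce simp: orbit_def)

lemma orbit_trans: "v \<in> V \<Longrightarrow> u \<in> orbit v \<Longrightarrow> w \<in> orbit u \<Longrightarrow> w \<in> orbit v"
  unfolding orbit_def using act_compose by (smt (verit) mem_Collect_eq)

lemma orbit_eq:
  assumes "v \<in> V" "w \<in> orbit v"
  shows "orbit w = orbit v"
proof -
  have "w \<in> V" using assms orbit_subset by blast
  then show ?thesis using orbit_trans orbit_sym assms by blast
qed

lemma orbit_closed:
  assumes "v \<in> V" "u \<in> orbit v" "w \<in> V" "x \<in> B" "d x u w \<noteq> 0"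
  shows "w \<in> orbit v"
  using assms orbit_trans[of v u w] by (auto simp: orbit_def)

lemma orbit_closed_back:
  assumes "v \<in> V" "w \<in> orbit v" "u \<in> V" "x \<in> B" "d x u w \<noteq> 0"
  shows "u \<in> orbit v"
proof -
  have w: "w \<in> V" using assms orbit_subset by blast
  then have "d (s x) w u \<noteq> 0" using assms act_star[of x u w] by simp
  then show ?thesis using orbit_closed[of v w u "s x"] assms w star_in by blast
qed

lemma fusion_module_orbit:
  assumes v: "v \<in> V"
  shows "fusion_module B e s c (orbit v) d"
proof -
  have in_V: "w \<in> V" if "w \<in> orbit v" for w using that orbit_subset by blast
  have *: "(\<Sum>z\<in>B. c x y z * d z u w) = (\<Sum>t\<in>orbit v. d y u t * d x t w)"
    if "x \<in> B" "y \<in> B" "u \<in> orbit v" "w \<in> orbit v" for x y u w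
  proof -
    have "(\<Sum>t\<in>orbit v. d y u t * d x t w) = (\<Sum>t\<in>V. d y u t * d x t w)"
      by (rule sum.mono_neutral_left[OF finite_V orbit_subset])
         (use orbit_closed[OF v that(3) _ that(2)] in auto)
    then show ?thesis using act_assoc that in_V by simp
  qed
  show ?thesis
  proof
    show "finite (orbit v)" using finite_V orbit_subset by (rule finite_subset[rotated])
  qed (use * in \<open>blast intro: in_V act_nonneg act_unit act_star\<close>)+
qed

lemma eigenvector_orbit:
  assumes v: "v \<in> V" and mu: "eigenvector f \<mu>"
  shows "fusion_module.eigenvector B (orbit v) d f \<mu>"
proof -
  interpret Orb: fusion_module B e s c "orbit v" d using v by (rule fusion_module_orbit)
  have in_V: "w \<in> V" if "w \<in> orbit v" for w using that orbit_subset by blast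
  have "(\<Sum>u\<in>orbit v. d x u w * \<mu> u) = (\<Sum>u\<in>V. d x u w * \<mu> u)" if "x \<in> B" "w \<in> orbit v" for x w
    by (rule sum.mono_neutral_left[OF finite_V orbit_subset])
       (use orbit_closed_back[OF v that(2) _ that(1)] in auto)
  then show ?thesis
    using mu in_V by (simp add: Orb.eigenvector_def eigenvector_def)
qed

lemma orbit_transitive:
  assumes v: "v \<in> V" and u: "u \<in> orbit v"
  shows "fusion_module.orbit B (orbit v) d u = orbit v"
proof -
  interpret Orb: fusion_module B e s c "orbit v" d using v by (rule fusion_module_orbit)
  have "Orb.orbit u = orbit v \<inter> orbit u"
    unfolding Orb.orbit_def by (auto simp: orbit_def)
  then show ?thesis using orbit_eq[OF v u] by simp
qed

lemma fusion_module_adj: "fusion_module adj e s c V d"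
proof -
  have *: "(\<Sum>z\<in>adj. c x y z * d z v w) = (\<Sum>u\<in>V. d y v u * d x u w)"
    if "x \<in> adj" "y \<in> adj" "v \<in> V" "w \<in> V" for x y v w
  proof -
    have "(\<Sum>z\<in>adj. c x y z * d z v w) = (\<Sum>z\<in>B. c x y z * d z v w)"
      by (rule sum.mono_neutral_left[OF finite_B adj_subset])
         (use that in \<open>auto dest: adjoint_closure.product\<close>)
    then show ?thesis using act_assoc that adj_in by simp
  qed
  interpret Adj: fusion_ring adj e s c by (rule fusion_ring_adj)
  show ?thesis
    by unfold_locales (use * in \<open>blast intro: finite_V adj_in act_nonneg act_unit act_star\<close>)+
qed

abbreviation adj_orbit :: "'m \<Rightarrow> 'm set"
  where "adj_orbit \<equiv> fusion_module.orbit adj V d"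

text \<open>
  A basic element maps each component for the adjoint subring into a single component.  The path
  from \<open>w\<close> back to \<open>v\<close> by \<open>x\<^sup>*\<close>, inside the component to \<open>v'\<close> by some adjoint \<open>a\<close>, and on to \<open>w'\<close> by
  \<open>x\<close> is an action of \<open>x a x\<^sup>*\<close>, which is adjoint by normality.
\<close>

lemma adj_orbit_translate:
  assumes x: "x \<in> B" and V: "v \<in> V" "w \<in> V" "v' \<in> V" "w' \<in> V"
    and vw: "d x v w \<noteq> 0" and vw': "d x v' w' \<noteq> 0" and "v' \<in> adj_orbit v"
  shows "w' \<in> adj_orbit w"
proof -
  interpret Adj: fusion_module adj e s c V d by (rule fusion_module_adj)
  obtain a where a: "a \<in> adj" "d a v v' \<noteq> 0" using assms by (auto simp: Adj.orbit_def)
  obtain u where u: "u \<in> B" "c x a u \<noteq> 0" "d u v w' \<noteq> 0"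
    using act_compose[OF a(2) vw' x] adj_in[OF a(1)] V by blast
  have "d (s x) w v \<noteq> 0" using vw act_star[OF x V(1,2)] by simp
  then obtain t where t: "t \<in> B" "c u (s x) t \<noteq> 0" "d t w w' \<noteq> 0"
    using act_compose[OF _ u(3)] u(1) V x star_in by blast
  have "t \<in> adj" using adj_normal[OF a(1) x u(1) t(1) u(2) t(2)] .
  then show ?thesis using t V by (auto simp: Adj.orbit_def)
qed

lemma adj_orbit_translate_iff:
  assumes x: "x \<in> B" and V: "v \<in> V" "w \<in> V" "v' \<in> V" "w' \<in> V"
    and vw: "d x v w \<noteq> 0" and vw': "d x v' w' \<noteq> 0"
  shows "v' \<in> adj_orbit v \<longleftrightarrow> w' \<in> adj_orbit w"
  using adj_orbit_translate[OF x V vw vw'] adj_orbit_translate[OF star_in[OF x] V(2,1,4,3)]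
    act_star[OF x V(1,2)] act_star[OF x V(3,4)] vw vw' by auto

text \<open>
  Let \<open>x\<close> map the component \<open>C\<close> of \<open>v\<close> into the component \<open>D\<close> of \<open>w\<close>.  The pairing of
  \<open>x \<mu>\<^sub>C\<close> with \<open>\<mu>\<^sub>D\<close>, the two restrictions of the eigenvector, is \<open>f x\<close> times the squared norm of
  \<open>\<mu>\<^sub>D\<close>.  Moving \<open>x\<close> to the other side as \<open>x\<^sup>*\<close>, which has the same dimension, it is also
  \<open>f x\<close> times the squared norm of \<open>\<mu>\<^sub>C\<close>.
\<close>

lemma adj_orbit_norm_eq:
  assumes f: "character f" and mu: "eigenvector f \<mu>"
    and x: "x \<in> B" and V: "v \<in> V" "w \<in> V" and vw: "d x v w \<noteq> 0"
  shows "(\<Sum>u\<in>adj_orbit v. (\<mu> u)\<^sup>2) = (\<Sum>u\<in>adj_orbit w. (\<mu> u)\<^sup>2)"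
proof -
  interpret Adj: fusion_module adj e s c V d by (rule fusion_module_adj)
  let ?C = "adj_orbit v" and ?D = "adj_orbit w"
  have into_D: "(\<Sum>v'\<in>?C. d x v' w' * \<mu> v') = f x * \<mu> w'" if w': "w' \<in> ?D" for w'
  proof -
    have "w' \<in> V" using w' Adj.orbit_subset by blast
    then have "(\<Sum>v'\<in>?C. d x v' w' * \<mu> v') = (\<Sum>v'\<in>V. d x v' w' * \<mu> v')"
      using adj_orbit_translate_iff[OF x V _ _ vw] w'
      by (intro sum.mono_neutral_left[OF finite_V Adj.orbit_subset]) auto
    then show ?thesis using mu x \<open>w' \<in> V\<close> by (simp add: eigenvector_def)
  qed
  have into_C: "(\<Sum>w'\<in>?D. d x v' w' * \<mu> w') = f x * \<mu> v'" if v': "v' \<in> ?C" for v'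
  proof -
    have v'V: "v' \<in> V" using v' Adj.orbit_subset by blast
    then have "(\<Sum>w'\<in>?D. d x v' w' * \<mu> w') = (\<Sum>w'\<in>V. d x v' w' * \<mu> w')"
      using adj_orbit_translate_iff[OF x V _ _ vw] v'
      by (intro sum.mono_neutral_left[OF finite_V Adj.orbit_subset]) auto
    also have "\<dots> = (\<Sum>w'\<in>V. d (s x) w' v' * \<mu> w')"
      using x v'V by (intro sum.cong refl) (simp add: act_star[of x v'])
    also have "\<dots> = f (s x) * \<mu> v'"
      using mu star_in[OF x] v'V by (simp add: eigenvector_def)
    finally show ?thesis using character_star[OF f x] by simp
  qed
  have "f x * (\<Sum>v'\<in>?C. (\<mu> v')\<^sup>2) = (\<Sum>v'\<in>?C. (f x * \<mu> v') * \<mu> v')"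
    by (simp add: sum_distrib_left power2_eq_square mult.assoc)
  also have "\<dots> = (\<Sum>v'\<in>?C. \<Sum>w'\<in>?D. d x v' w' * \<mu> w' * \<mu> v')"
    by (simp add: into_C[symmetric] sum_distrib_right)
  also have "\<dots> = (\<Sum>w'\<in>?D. \<Sum>v'\<in>?C. d x v' w' * \<mu> w' * \<mu> v')"
    by (rule sum.swap)
  also have "\<dots> = (\<Sum>w'\<in>?D. (\<Sum>v'\<in>?C. d x v' w' * \<mu> v') * \<mu> w')"
    by (simp add: sum_distrib_left sum_distrib_right mult_ac)
  also have "\<dots> = f x * (\<Sum>w'\<in>?D. (\<mu> w')\<^sup>2)"
    by (simp add: into_D sum_distrib_left power2_eq_square mult.assoc)
  finally show ?thesis using character_pos[OF f x] by simp
qed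

lemma norm_eq_card_adj_orbits:
  assumes f: "character f" and mu: "eigenvector f \<mu>"
    and v: "v \<in> V" and trans: "orbit v = V"
  shows "(\<Sum>u\<in>V. (\<mu> u)\<^sup>2) = real (card (adj_orbit ` V)) * (\<Sum>u\<in>adj_orbit v. (\<mu> u)\<^sup>2)"
proof -
  interpret Adj: fusion_module adj e s c V d by (rule fusion_module_adj)
  have "V = \<Union>(adj_orbit ` V)" using Adj.orbit_refl Adj.orbit_subset by blast
  then have "(\<Sum>u\<in>V. (\<mu> u)\<^sup>2) = (\<Sum>u\<in>\<Union>(adj_orbit ` V). (\<mu> u)\<^sup>2)" by simp
  also have "\<dots> = (\<Sum>C\<in>adj_orbit ` V. \<Sum>u\<in>C. (\<mu> u)\<^sup>2)"
  proof -
    have "\<forall>C\<in>adj_orbit ` V. finite C"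
      using Adj.orbit_subset finite_V by (blast intro: finite_subset)
    moreover have "\<forall>C\<in>adj_orbit ` V. \<forall>D\<in>adj_orbit ` V. C \<noteq> D \<longrightarrow> C \<inter> D = {}"
      using Adj.orbit_eq by blast
    ultimately show ?thesis by (simp only: sum.Union_disjoint o_apply)
  qed
  also have "\<dots> = (\<Sum>C\<in>adj_orbit ` V. \<Sum>u\<in>adj_orbit v. (\<mu> u)\<^sup>2)"
  proof (rule sum.cong[OF refl])
    fix C assume "C \<in> adj_orbit ` V"
    then obtain w where w: "w \<in> V" "C = adj_orbit w" by blast
    then obtain x where "x \<in> B" "d x v w \<noteq> 0" using trans by (auto simp: orbit_def)
    then show "(\<Sum>u\<in>C. (\<mu> u)\<^sup>2) = (\<Sum>u\<in>adj_orbit v. (\<mu> u)\<^sup>2)"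
      using adj_orbit_norm_eq[OF f mu _ v] w by metis
  qed
  also have "\<dots> = real (card (adj_orbit ` V)) * (\<Sum>u\<in>adj_orbit v. (\<mu> u)\<^sup>2)" by simp
  finally show ?thesis .
qed

lemma eigenvector_adj:
  assumes "eigenvector f \<mu>"
  shows "fusion_module.eigenvector adj V d f \<mu>"
proof -
  interpret Adj: fusion_module adj e s c V d by (rule fusion_module_adj)
  show ?thesis using assms adj_in by (simp add: Adj.eigenvector_def eigenvector_def)
qed

text \<open>
  The regular element, the sum of the basis weighted with dimensions, is absorbed by every left
  multiplication up to the factor \<open>f y\<close>.  Its image of any basic vector is therefore an eigenvector,
  and transitivity makes it positive.
\<close>

lemma eigenvector_exists:
  assumes f: "character f" and v: "v \<in> V" and trans: "orbit v = V"
  shows "\<exists>\<mu>. eigenvector f \<mu>"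
proof
  let ?\<mu> = "\<lambda>w. \<Sum>x\<in>B. f x * d x v w"
  show "eigenvector f ?\<mu>"
    unfolding eigenvector_def
  proof (intro conjI ballI)
    fix w assume w: "w \<in> V"
    then obtain x where x: "x \<in> B" "d x v w \<noteq> 0" using trans by (auto simp: orbit_def)
    show "0 < ?\<mu> w"
      by (rule sum_pos2[OF finite_B x(1)])
         (use x v w character_pos[OF f] act_nonneg in \<open>auto simp: less_le\<close>)
  next
    fix y w assume y: "y \<in> B" and w: "w \<in> V"
    have "(\<Sum>u\<in>V. d y u w * ?\<mu> u) = (\<Sum>u\<in>V. \<Sum>x\<in>B. f x * (d x v u * d y u w))"
      by (simp add: sum_distrib_left mult_ac)
    also have "\<dots> = (\<Sum>x\<in>B. f x * (\<Sum>u\<in>V. d x v u * d y u w))"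
      by (subst sum.swap) (simp add: sum_distrib_left)
    also have "\<dots> = (\<Sum>x\<in>B. f x * (\<Sum>z\<in>B. c y x z * d z v w))"
      using y v w by (simp add: act_assoc)
    also have "\<dots> = (\<Sum>z\<in>B. (\<Sum>x\<in>B. c y x z * f x) * d z v w)"
      by (simp add: sum_distrib_left sum_distrib_right mult_ac) (rule sum.swap)
    also have "\<dots> = (\<Sum>z\<in>B. (\<Sum>x\<in>B. c (s y) z x * f x) * d z v w)"
      using y by (intro sum.cong refl) (simp add: frobenius_left[of y])
    also have "\<dots> = (\<Sum>z\<in>B. f y * f z * d z v w)"
      using y by (intro sum.cong refl) (simp add: character_mult[OF f] star_in character_star[OF f])
    finally show "(\<Sum>u\<in>V. d y u w * ?\<mu> u) = f y * ?\<mu> w"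
      by (simp add: sum_distrib_left mult.assoc)
  qed
qed

end

text \<open>
  At each step the squared norm of \<open>\<mu>\<close> is the number of components for the adjoint subring times the
  squared norm on one of them, so integrality is inherited from the adjoint subring.  When only the
  unit is left, a transitive module has one basic element and the quotient is \<open>1\<close>.  Any eigenvector
  will do, because restricting it to a component gives an eigenvector again.
\<close>

theorem nilpotent_norm_quotient_integral:
  assumes "((\<lambda>A. adjoint_closure A s c) ^^ n) B = {e}"
    and "fusion_module B e s c V d" and "fusion_ring.character B c f"
    and "fusion_module.eigenvector B V d f \<mu>"
    and "v \<in> V" and "fusion_module.orbit B V d v = V"
  shows "(\<Sum>u\<in>V. (\<mu> u)\<^sup>2) / (\<mu> v)\<^sup>2 \<in> \<int>"
  using assms
proof (induction n arbitrary: B V)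
  case 0
  then interpret fusion_module B e s c V d by simp
  have "w = v" if "w \<in> V" for w
  proof -
    have "w \<in> orbit v" using that \<open>orbit v = V\<close> by simp
    then obtain x where "x \<in> B" "d x v w \<noteq> 0" by (auto simp: orbit_def)
    moreover have "B = {e}" using 0 by simp
    ultimately show ?thesis using act_unit[of v w] that \<open>v \<in> V\<close> by (auto split: if_splits)
  qed
  then have "V = {v}" using \<open>v \<in> V\<close> by blast
  moreover have "\<mu> v \<noteq> 0"
    using \<open>eigenvector f \<mu>\<close> \<open>v \<in> V\<close> by (auto simp: eigenvector_def)
  ultimately show ?case by simp
next
  case (Suc n)
  interpret fusion_module B e s c V d by fact
  interpret Adj: fusion_module adj e s c V d by (rule fusion_module_adj)
  note f = \<open>character f\<close> and mu = \<open>eigenvector f \<mu>\<close> and v = \<open>v \<in> V\<close>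
  have "((\<lambda>A. adjoint_closure A s c) ^^ n) adj = {e}"
    using Suc.prems(1) by (simp add: funpow_Suc_right del: funpow.simps)
  then have "(\<Sum>u\<in>adj_orbit v. (\<mu> u)\<^sup>2) / (\<mu> v)\<^sup>2 \<in> \<int>"
    by (rule Suc.IH[OF _ Adj.fusion_module_orbit[OF v] character_adj[OF f]
          Adj.eigenvector_orbit[OF v eigenvector_adj[OF mu]] Adj.orbit_refl[OF v]
          Adj.orbit_transitive[OF v Adj.orbit_refl[OF v]]])
  then have "real (card (adj_orbit ` V)) * ((\<Sum>u\<in>adj_orbit v. (\<mu> u)\<^sup>2) / (\<mu> v)\<^sup>2) \<in> \<int>"
    by (intro Ints_mult) auto
  then show ?case using norm_eq_card_adj_orbits[of f \<mu> v] Suc.prems by simp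
qed

section \<open>The ring as a module over its adjoint subring\<close>

context fusion_ring
begin

lemma fusion_module_regular: "fusion_module B e s c B c"
  by unfold_locales (simp_all add: finite_B nonneg unit_left assoc frobenius_left[symmetric])

lemma eigenvector_regular:
  assumes f: "character f"
  shows "fusion_module.eigenvector B B c f f"
proof -
  interpret Reg: fusion_module B e s c B c by (rule fusion_module_regular)
  have "(\<Sum>v\<in>B. c x v w * f v) = f x * f w" if "x \<in> B" "w \<in> B" for x w
  proof -
    have "(\<Sum>v\<in>B. c x v w * f v) = (\<Sum>v\<in>B. c (s x) w v * f v)"
      using that by (intro sum.cong refl) (simp add: frobenius_left[of x])
    then show ?thesis using that by (simp add: character_mult[OF f] star_in character_star[OF f])
  qed
  then show ?thesis by (simp add: Reg.eigenvector_def character_pos[OF f])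
qed

text \<open>
  The component of \<open>x\<close> in the ring, as a left module over its adjoint subring, is the coset of \<open>x\<close>.
  Right multiplication by \<open>x\<close> maps the adjoint subring into it, and right multiplication by \<open>x\<^sup>*\<close>
  maps it back because \<open>a x x\<^sup>*\<close> is adjoint.  Computing the pairing in two ways, as for modules,
  shows that both have the same norm.
\<close>

lemma adj_coset_norm_eq:
  assumes f: "character f" and x: "x \<in> B"
  shows "(\<Sum>y\<in>fusion_module.orbit adj B c x. (f y)\<^sup>2) = (\<Sum>y\<in>adj. (f y)\<^sup>2)"
proof -
  interpret Reg: fusion_module B e s c B c by (rule fusion_module_regular)
  interpret Adj: fusion_module adj e s c B c by (rule Reg.fusion_module_adj)
  let ?D = "Adj.orbit x"
  have into_D: "(\<Sum>w\<in>?D. c y x w * f w) = f y * f x" if y: "y \<in> adj" for y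
  proof -
    have "(\<Sum>w\<in>?D. c y x w * f w) = (\<Sum>w\<in>B. c y x w * f w)"
      using y by (intro sum.mono_neutral_left[OF finite_B Adj.orbit_subset]) (auto simp: Adj.orbit_def)
    then show ?thesis using character_mult[OF f adj_in[OF y] x] by simp
  qed
  have into_adj: "(\<Sum>y\<in>adj. c y x w * f y) = f w * f x" if w: "w \<in> ?D" for w
  proof -
    have wB: "w \<in> B" using w Adj.orbit_subset by blast
    obtain a where a: "a \<in> adj" "c a x w \<noteq> 0" using w by (auto simp: Adj.orbit_def)
    have "y \<in> adj" if y: "y \<in> B" "c y x w \<noteq> 0" for y
    proof -
      have "c w (s x) y \<noteq> 0" using frobenius_right[OF y(1) x wB] y(2) by simp
      then obtain b where "b \<in> B" "c x (s x) b \<noteq> 0" "c a b y \<noteq> 0"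
        using assoc_rightD[OF a(2)] adj_in[OF a(1)] x y(1) wB star_in by blast
      then show ?thesis using a x y by (blast intro: adjoint_closure.square adjoint_closure.product)
    qed
    then have "(\<Sum>y\<in>adj. c y x w * f y) = (\<Sum>y\<in>B. c y x w * f y)"
      by (intro sum.mono_neutral_left[OF finite_B adj_subset]) auto
    also have "\<dots> = (\<Sum>y\<in>B. c w (s x) y * f y)"
      using x wB by (intro sum.cong refl) (simp add: frobenius_right[of _ x w])
    also have "\<dots> = f w * f x"
      using character_mult[OF f wB star_in[OF x]] character_star[OF f x] by simp
    finally show ?thesis .
  qed
  have "f x * (\<Sum>y\<in>adj. (f y)\<^sup>2) = (\<Sum>y\<in>adj. (f y * f x) * f y)"
    by (simp add: sum_distrib_left power2_eq_square mult_ac)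
  also have "\<dots> = (\<Sum>y\<in>adj. \<Sum>w\<in>?D. c y x w * f w * f y)"
    by (simp add: into_D[symmetric] sum_distrib_right)
  also have "\<dots> = (\<Sum>w\<in>?D. \<Sum>y\<in>adj. c y x w * f w * f y)"
    by (rule sum.swap)
  also have "\<dots> = (\<Sum>w\<in>?D. (\<Sum>y\<in>adj. c y x w * f y) * f w)"
    by (simp add: sum_distrib_left sum_distrib_right mult_ac)
  also have "\<dots> = f x * (\<Sum>w\<in>?D. (f w)\<^sup>2)"
    by (simp add: into_adj) (simp add: sum_distrib_left power2_eq_square mult_ac)
  finally show ?thesis using character_pos[OF f x] by simp
qed

theorem nilpotent_adj_norm_quotient_integral:
  assumes "((\<lambda>A. adjoint_closure A s c) ^^ n) B = {e}"
    and f: "character f" and x: "x \<in> B"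
  shows "(\<Sum>y\<in>adj. (f y)\<^sup>2) / (f x)\<^sup>2 \<in> \<int>"
proof -
  obtain m where nil: "((\<lambda>A. adjoint_closure A s c) ^^ m) adj = {e}"
  proof (cases n)
    case 0
    then have "adj = {e}" using assms(1) adj_subset unit_in_adj by auto
    then show ?thesis using that[of 0] by simp
  next
    case (Suc m)
    then show ?thesis using that[of m] assms(1) by (simp add: funpow_Suc_right del: funpow.simps)
  qed
  interpret Reg: fusion_module B e s c B c by (rule fusion_module_regular)
  interpret Adj: fusion_module adj e s c B c by (rule Reg.fusion_module_adj)
  have "(\<Sum>y\<in>Adj.orbit x. (f y)\<^sup>2) / (f x)\<^sup>2 \<in> \<int>"
    by (rule nilpotent_norm_quotient_integral[OF nil Adj.fusion_module_orbit[OF x] character_adj[OF f]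
          Adj.eigenvector_orbit[OF x Reg.eigenvector_adj[OF eigenvector_regular[OF f]]]
          Adj.orbit_refl[OF x] Adj.orbit_transitive[OF x Adj.orbit_refl[OF x]]])
  then show ?thesis by (simp add: adj_coset_norm_eq[OF f x])
qed

end

section \<open>Based rings in coordinates\<close>

text \<open>
  Additivity alone gives linearity over the integers.  The homomorphisms and actions below are only
  known to be additive on the span, not on the ambient type.
\<close>

lemma additive_zspan:
  fixes f :: "'g::ab_group_add \<Rightarrow> 'h::ab_group_add"
  assumes add: "\<And>x y. x \<in> zspan B \<Longrightarrow> y \<in> zspan B \<Longrightarrow> f (x + y) = f x + f y"
    and fin: "finite B" and ind: "zindependent B" and x: "x \<in> zspan B"
  shows "f x = (\<Sum>b\<in>B. zmult (zcoeff B x b) (f b))"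
proof -
  have zero: "f 0 = 0" using add[of 0 0] zm.span_zero[of B] by simp
  have nat: "f (zmult (int n) y) = zmult (int n) (f y)" if y: "y \<in> zspan B" for n y
  proof (induction n)
    case (Suc n)
    have "f (zmult (int (Suc n)) y) = f (zmult (int n) y + y)"
      by (simp add: zm.scale_left_distrib add.commute)
    also have "\<dots> = zmult (int (Suc n)) (f y)"
      using y Suc by (simp add: add zm.span_scale zm.scale_left_distrib add.commute)
    finally show ?case .
  qed (simp add: zero)
  have minus: "f (- y) = - f y" if y: "y \<in> zspan B" for y
    using add[of y "- y"] y zero by (simp add: zm.span_neg eq_neg_iff_add_eq_0 add.commute)
  have scale: "f (zmult k y) = zmult k (f y)" if y: "y \<in> zspan B" for k y
  proof (cases k)
    case (nonneg n)
    then show ?thesis using nat[OF y] by simp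
  next
    case (neg n)
    then show ?thesis
      using nat[OF y, of "Suc n"] minus[of "zmult (int (Suc n)) y"] y
      by (simp only: zm.scale_minus_left zm.span_scale)
  qed
  have "f (\<Sum>b\<in>C. zmult (k b) b) = (\<Sum>b\<in>C. zmult (k b) (f b))" if "C \<subseteq> B" for k C
    using finite_subset[OF that fin] that
  proof (induction C rule: finite_induct)
    case (insert c C)
    have "(\<Sum>b\<in>C. zmult (k b) b) \<in> zspan B"
      using insert by (intro zm.span_sum zm.span_scale zm.span_base) auto
    then show ?case
      using insert by (simp add: add scale zm.span_scale zm.span_base)
  qed (simp add: zero)
  from this[of B "zcoeff B x"] show ?thesis
    by (simp add: zm.sum_representation_eq[OF ind x fin order_refl])
qed

lemma zcoeff_lincomb:
  assumes ind: "zindependent B" and v: "\<And>i. i \<in> I \<Longrightarrow> v i \<in> zspan B"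
  shows "zcoeff B (\<Sum>i\<in>I. zmult (k i) (v i)) w = (\<Sum>i\<in>I. k i * zcoeff B (v i) w)"
proof -
  have "zcoeff B (\<Sum>i\<in>I. zmult (k i) (v i)) = (\<lambda>w. \<Sum>i\<in>I. zcoeff B (zmult (k i) (v i)) w)"
    using v by (intro zm.representation_sum[OF ind] zm.span_scale)
  then show ?thesis using v by (simp add: zm.representation_scale[OF ind])
qed

abbreviation structure_constant :: "'a::ring_1 set \<Rightarrow> 'a \<Rightarrow> 'a \<Rightarrow> 'a \<Rightarrow> real"
  where "structure_constant B x y z \<equiv> real_of_int (zcoeff B (x * y) z)"

context based_ring
begin

lemma basis_subset: "b \<in> B \<Longrightarrow> b \<in> R"
  by (simp add: span_basis zm.span_base)

lemma expansion: "x \<in> R \<Longrightarrow> (\<Sum>b\<in>B. zmult (zcoeff B x b) b) = x"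
  using zm.sum_representation_eq[OF independent_basis _ finite_basis order_refl] span_basis by simp

lemma zcoeff_basic: "b \<in> B \<Longrightarrow> zcoeff B b v = (if v = b then 1 else 0)"
  using zm.representation_basis[OF independent_basis] by simp

lemma mult_expansion:
  assumes "x \<in> R" "y \<in> R"
  shows "x * y = (\<Sum>a\<in>B. zmult (zcoeff B x a) (a * y))"
    and "x * y = (\<Sum>b\<in>B. zmult (zcoeff B y b) (x * b))"
  using additive_zspan[OF _ finite_basis independent_basis, of "\<lambda>x. x * y" x]
    additive_zspan[OF _ finite_basis independent_basis, of "\<lambda>y. x * y" y] assms span_basis
  by (simp_all add: distrib_left distrib_right)

lemma based_involution_basic_star: "based_involution R B (basic_star R B)"
  unfolding basic_star_def using involution by (rule someI_ex)

lemma star_extend_basic: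
  assumes "b \<in> B"
  shows "star_extend B s b = s b"
proof -
  have "star_extend B s b = (\<Sum>a\<in>B. if a = b then s a else 0)"
    unfolding star_extend_def using assms by (intro sum.cong) (auto simp: zcoeff_basic)
  then show ?thesis using assms finite_basis by simp
qed

lemma basis_form_basic:
  assumes "b \<in> B"
  shows "basis_form B x b = zcoeff B x b" and "basis_form B b x = zcoeff B x b"
  using assms finite_basis by (simp_all add: basis_form_def zcoeff_basic if_distrib if_distribR cong: if_cong)

lemma zcoeff_frobenius:
  assumes s: "based_involution R B s" and xyz: "x \<in> B" "y \<in> B" "z \<in> B"
  shows "zcoeff B (x * y) z = zcoeff B (z * s y) x"
    and "zcoeff B (x * y) z = zcoeff B (s x * z) y"
proof -
  have "basis_form B (x * y) z = basis_form B x (z * star_extend B s y) \<and>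
       basis_form B (x * y) z = basis_form B y (star_extend B s x * z)"
    using s xyz basis_subset unfolding based_involution_def by blast
  then show "zcoeff B (x * y) z = zcoeff B (z * s y) x"
    and "zcoeff B (x * y) z = zcoeff B (s x * z) y"
    using xyz by (simp_all add: basis_form_basic star_extend_basic)
qed

text \<open>
  The coefficient of \<open>1\<close> in \<open>b d\<close> is \<open>1\<close> for \<open>d = b\<^sup>*\<close> and \<open>0\<close> for every other basic \<open>d\<close>, so the
  product determines the involution.
\<close>

lemma based_involution_unique:
  assumes s: "based_involution R B s" and t: "based_involution R B t" and b: "b \<in> B"
  shows "s b = t b"
proof -
  have "zcoeff B (b * d) 1 = (if d = r b then 1 else 0)"
    if r: "based_involution R B r" and d: "d \<in> B" for r d
  proof -
    have "r b \<in> B" using r b by (simp add: based_involution_def)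
    then show ?thesis using zcoeff_frobenius(2)[OF r b d one_basic] by (simp add: zcoeff_basic)
  qed
  from this[OF s, of "s b"] this[OF t, of "s b"] show ?thesis
    using s b by (auto simp: based_involution_def split: if_splits)
qed

lemma fusion_ring_structure: "fusion_ring B 1 (basic_star R B) (structure_constant B)"
proof
  note s = based_involution_basic_star
  fix x assume "x \<in> B"
  then show "basic_star R B x \<in> B" "basic_star R B (basic_star R B x) = x"
    using s by (auto simp: based_involution_def)
next
  fix x y w t assume B: "x \<in> B" "y \<in> B" "w \<in> B" "t \<in> B"
  note R = B[THEN basis_subset]
  have "(\<Sum>z\<in>B. zcoeff B (x * y) z * zcoeff B (z * w) t)
    = zcoeff B (\<Sum>z\<in>B. zmult (zcoeff B (x * y) z) (z * w)) t"
    using R basis_subset mult_closed span_basis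
    by (intro zcoeff_lincomb[symmetric] independent_basis) blast
  also have "\<dots> = zcoeff B (x * y * w) t"
    using R by (simp add: mult_expansion(1)[of "x * y" w] mult_closed)
  also have "\<dots> = zcoeff B (x * (y * w)) t" by (simp add: mult.assoc)
  also have "\<dots> = zcoeff B (\<Sum>z\<in>B. zmult (zcoeff B (y * w) z) (x * z)) t"
    using R by (simp add: mult_expansion(2)[of x "y * w"] mult_closed)
  also have "\<dots> = (\<Sum>z\<in>B. zcoeff B (y * w) z * zcoeff B (x * z) t)"
    using R basis_subset mult_closed span_basis
    by (intro zcoeff_lincomb independent_basis) blast
  finally have "real_of_int (\<Sum>z\<in>B. zcoeff B (x * y) z * zcoeff B (z * w) t)
    = real_of_int (\<Sum>z\<in>B. zcoeff B (y * w) z * zcoeff B (x * z) t)" by simp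
  then show "(\<Sum>z\<in>B. structure_constant B x y z * structure_constant B z w t)
    = (\<Sum>z\<in>B. structure_constant B y w z * structure_constant B x z t)" by simp
next
  note s = based_involution_basic_star
  fix x y z assume "x \<in> B" "y \<in> B" "z \<in> B"
  then show "structure_constant B x y z = structure_constant B z (basic_star R B y) x"
    "structure_constant B x y z = structure_constant B (basic_star R B x) z y"
    using zcoeff_frobenius[OF s] by simp_all
qed (auto simp: finite_basis one_basic structure_nonneg zcoeff_basic)

sublocale fusion_ring B 1 "basic_star R B" "structure_constant B"
  by (rule fusion_ring_structure)

lemma additive_basis_sum:
  fixes f :: "'a \<Rightarrow> real"
  assumes "\<And>x y. x \<in> R \<Longrightarrow> y \<in> R \<Longrightarrow> f (x + y) = f x + f y" and "x \<in> R"
  shows "f x = (\<Sum>b\<in>B. real_of_int (zcoeff B x b) * f b)"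
  using additive_zspan[OF _ finite_basis independent_basis, of f x] assms span_basis
  by (simp add: zmult_eq_of_int)

text \<open>
  The property whose unique solution is \<^const>\<open>FPdim\<close>.
\<close>

definition positive_hom :: "('a \<Rightarrow> real) \<Rightarrow> bool"
  where "positive_hom f \<longleftrightarrow> f \<in> extensional R \<and> f 1 = 1 \<and>
    (\<forall>x\<in>R. \<forall>y\<in>R. f (x + y) = f x + f y \<and> f (x * y) = f x * f y) \<and>
    (\<forall>b\<in>B. 0 < f b)"

lemma positive_hom_character:
  assumes f: "positive_hom f"
  shows "character f"
  unfolding character_def
proof (intro conjI ballI)
  fix x y assume "x \<in> B" "y \<in> B"
  then have R: "x \<in> R" "y \<in> R" by (simp_all add: basis_subset)
  have "f (x * y) = (\<Sum>z\<in>B. structure_constant B x y z * f z)"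
    using f R by (intro additive_basis_sum mult_closed) (simp_all add: positive_hom_def)
  then show "(\<Sum>z\<in>B. structure_constant B x y z * f z) = f x * f y"
    using f R by (simp add: positive_hom_def)
qed (use f in \<open>simp add: positive_hom_def\<close>)

text \<open>
  A character extends linearly from the basis; multiplicativity extends one factor at a time.
\<close>

lemma positive_hom_exists: "\<exists>f. positive_hom f"
proof -
  obtain g where g: "character g" using character_exists by blast
  define h where "h x = (if x \<in> R then \<Sum>b\<in>B. real_of_int (zcoeff B x b) * g b else undefined)" for x
  have hR: "h x = (\<Sum>b\<in>B. real_of_int (zcoeff B x b) * g b)" if "x \<in> R" for x
    using that by (simp add: h_def)
  have hB: "h b = g b" if "b \<in> B" for b
  proof -
    have "h b = (\<Sum>a\<in>B. if a = b then g a else 0)"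
      unfolding hR[OF basis_subset[OF that]] using that by (intro sum.cong) (auto simp: zcoeff_basic)
    then show ?thesis using that finite_basis by simp
  qed
  have add_closed: "x + y \<in> R" if "x \<in> R" "y \<in> R" for x y
    using that span_basis by (simp add: zm.span_add)
  have add: "h (x + y) = h x + h y" if "x \<in> R" "y \<in> R" for x y
    using that add_closed span_basis
    by (simp add: hR zm.representation_add[OF independent_basis] distrib_right sum.distrib)
  have mult_basic: "h (a * b) = g a * g b" if "a \<in> B" "b \<in> B" for a b
    using that character_mult[OF g] by (simp add: hR mult_closed basis_subset)
  have mult_right: "h (x * b) = h x * g b" if x: "x \<in> R" and b: "b \<in> B" for x b
  proof -
    have "h (x * b) = (\<Sum>a\<in>B. real_of_int (zcoeff B x a) * h (a * b))"
      using x b by (intro additive_basis_sum[of "\<lambda>x. h (x * b)"])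
        (simp_all add: distrib_right add mult_closed basis_subset)
    then show ?thesis using x b by (simp add: mult_basic hR sum_distrib_right mult.assoc)
  qed
  have "h (x * y) = h x * h y" if x: "x \<in> R" and y: "y \<in> R" for x y
  proof -
    have "h (x * y) = (\<Sum>b\<in>B. real_of_int (zcoeff B y b) * h (x * b))"
      using x y by (intro additive_basis_sum[of "\<lambda>y. h (x * y)"])
        (simp_all add: distrib_left add mult_closed)
    also have "\<dots> = (\<Sum>b\<in>B. h x * (real_of_int (zcoeff B y b) * g b))"
      using x by (intro sum.cong refl) (simp add: mult_right)
    also have "\<dots> = h x * h y" by (simp only: hR[OF y] sum_distrib_left)
    finally show ?thesis .
  qed
  then have "positive_hom h"
    using add hB character_pos[OF g] character_unit[OF g] one_basic
    by (simp add: positive_hom_def extensional_def hB) (simp add: h_def)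
  then show ?thesis by blast
qed

lemma positive_hom_FPdim: "positive_hom (FPdim R B)"
proof -
  have "\<exists>!f. positive_hom f"
  proof (rule ex_ex1I[OF positive_hom_exists])
    fix f g assume f: "positive_hom f" and g: "positive_hom g"
    show "f = g"
    proof (rule extensionalityI[of _ R])
      fix x assume x: "x \<in> R"
      have "f x = (\<Sum>b\<in>B. real_of_int (zcoeff B x b) * f b)"
        using f x by (intro additive_basis_sum) (simp_all add: positive_hom_def)
      also have "\<dots> = (\<Sum>b\<in>B. real_of_int (zcoeff B x b) * g b)"
        using character_unique[OF f[THEN positive_hom_character] g[THEN positive_hom_character]] by simp
      also have "\<dots> = g x"
        using g x by (intro additive_basis_sum[symmetric]) (simp_all add: positive_hom_def)
      finally show "f x = g x" .
    qed (use f g in \<open>simp_all add: positive_hom_def\<close>)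
  qed
  then have "positive_hom (THE f. positive_hom f)" by (rule theI')
  moreover have "FPdim R B = (THE f. positive_hom f)" by (simp only: FPdim_def positive_hom_def)
  ultimately show ?thesis by simp
qed

lemma character_FPdim: "character (FPdim R B)"
  using positive_hom_FPdim by (rule positive_hom_character)

lemma FPdim_expansion: "x \<in> R \<Longrightarrow> FPdim R B x = (\<Sum>b\<in>B. real_of_int (zcoeff B x b) * FPdim R B b)"
  using positive_hom_FPdim by (intro additive_basis_sum) (simp_all add: positive_hom_def)

end

section \<open>The adjoint series in coordinates\<close>

lemma adjoint_closure_cong:
  assumes A: "A \<subseteq> B"
    and s: "\<And>x. x \<in> B \<Longrightarrow> s x \<in> B" "\<And>x. x \<in> B \<Longrightarrow> t x = s x"
    and c: "\<And>x y z. x \<in> B \<Longrightarrow> y \<in> B \<Longrightarrow> z \<in> B \<Longrightarrow> k x y z = c x y z"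
  shows "adjoint_closure A t k = adjoint_closure A s c"
proof (intro set_eqI iffI)
  have in_B: "x \<in> B" if "x \<in> A" for x using that A by blast
  have sub: "x \<in> A" if "x \<in> adjoint_closure A r h" for r h x
    using that by (auto elim: adjoint_closure.cases)
  fix x
  show "x \<in> adjoint_closure A s c" if "x \<in> adjoint_closure A t k"
    using that
  proof induction
    case (square x z)
    then have "c x (s x) z \<noteq> 0" using s c[of x "s x" z] in_B by simp
    with square(1,2) show ?case by (rule adjoint_closure.square)
  next
    case (product x y z)
    then have "c x y z \<noteq> 0" using c[of x y z] in_B sub by simp
    with product.IH product.hyps(3) show ?case by (rule adjoint_closure.product)
  qed
  show "x \<in> adjoint_closure A t k" if "x \<in> adjoint_closure A s c"
    using that
  proof induction
    case (square x z)
    then have "k x (t x) z \<noteq> 0" using s c[of x "s x" z] in_B by simp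
    with square(1,2) show ?case by (rule adjoint_closure.square)
  next
    case (product x y z)
    then have "k x y z \<noteq> 0" using c[of x y z] in_B sub by simp
    with product.IH product.hyps(3) show ?case by (rule adjoint_closure.product)
  qed
qed

text \<open>
  The involution and the structure constants of the adjoint subring are different functions from
  those of the whole ring, but they agree on its basis.  This suffices for the iterates.
\<close>

lemma funpow_adjoint_closure_cong:
  assumes "\<And>x. x \<in> B \<Longrightarrow> s x \<in> B" "\<And>x. x \<in> B \<Longrightarrow> t x = s x"
    and "\<And>x y z. x \<in> B \<Longrightarrow> y \<in> B \<Longrightarrow> z \<in> B \<Longrightarrow> k x y z = c x y z"
  shows "((\<lambda>A. adjoint_closure A t k) ^^ n) B = ((\<lambda>A. adjoint_closure A s c) ^^ n) B"
proof -
  have "((\<lambda>A. adjoint_closure A t k) ^^ n) B = ((\<lambda>A. adjoint_closure A s c) ^^ n) B \<and>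
    ((\<lambda>A. adjoint_closure A s c) ^^ n) B \<subseteq> B"
  proof (induction n)
    case (Suc n)
    let ?A = "((\<lambda>A. adjoint_closure A s c) ^^ n) B"
    have "adjoint_closure ?A s c \<subseteq> ?A" by (auto elim: adjoint_closure.cases)
    moreover have "adjoint_closure ?A t k = adjoint_closure ?A s c"
      using Suc assms by (intro adjoint_closure_cong[of ?A B]) auto
    ultimately show ?case using Suc by auto
  qed simp
  then show ?thesis ..
qed

context based_ring
begin

lemma zcoeff_subset: "C \<subseteq> B \<Longrightarrow> x \<in> zspan C \<Longrightarrow> zcoeff C x = zcoeff B x"
  using zm.representation_extend[OF independent_basis] by metis

lemma in_zspan_iff:
  assumes C: "C \<subseteq> B" and x: "x \<in> R"
  shows "x \<in> zspan C \<longleftrightarrow> (\<forall>b\<in>B. zcoeff B x b \<noteq> 0 \<longrightarrow> b \<in> C)"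
proof
  assume "x \<in> zspan C"
  then show "\<forall>b\<in>B. zcoeff B x b \<noteq> 0 \<longrightarrow> b \<in> C"
    using zcoeff_subset[OF C] zm.representation_ne_zero by metis
next
  assume *: "\<forall>b\<in>B. zcoeff B x b \<noteq> 0 \<longrightarrow> b \<in> C"
  have "zmult (zcoeff B x b) b \<in> zspan C" if "b \<in> B" for b
    using * that by (cases "zcoeff B x b = 0") (auto intro: zm.span_zero zm.span_scale zm.span_base)
  then have "(\<Sum>b\<in>B. zmult (zcoeff B x b) b) \<in> zspan C" by (rule zm.span_sum)
  then show "x \<in> zspan C" using expansion[OF x] by simp
qed

text \<open>
  Coefficients with respect to \<open>C\<close> are coefficients with respect to \<open>B\<close>, so the form and the
  involution of the ring restrict to the span of \<open>C\<close>.
\<close>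

lemma based_subring_zspan:
  assumes C: "C \<subseteq> B" and one: "1 \<in> C"
    and star: "\<And>x. x \<in> C \<Longrightarrow> basic_star R B x \<in> C"
    and closed: "\<And>x y z. x \<in> C \<Longrightarrow> y \<in> C \<Longrightarrow> z \<in> B \<Longrightarrow> zcoeff B (x * y) z \<noteq> 0 \<Longrightarrow> z \<in> C"
  shows "based_ring (zspan C) C" and "based_involution (zspan C) C (basic_star R B)"
proof -
  let ?s = "basic_star R B"
  have finC: "finite C" using C finite_basis by (rule finite_subset)
  have indC: "zindependent C" using independent_basis C by (rule zm.independent_mono)
  have in_B: "x \<in> B" if "x \<in> C" for x using that C by blast
  have in_R: "x \<in> R" if "x \<in> zspan C" for x using that zm.span_mono[OF C] span_basis by blast
  have basic_mult: "x * y \<in> zspan C" if "x \<in> C" "y \<in> C" for x y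
    using closed[OF that] that[THEN in_B] by (simp add: in_zspan_iff[OF C] mult_closed basis_subset)
  have mult_basic: "x * y \<in> zspan C" if x: "x \<in> zspan C" and y: "y \<in> C" for x y
  proof -
    have "x * y = (\<Sum>a\<in>C. zmult (zcoeff C x a) (a * y))"
      using x by (intro additive_zspan[OF _ finC indC, of "\<lambda>x. x * y"]) (simp_all add: distrib_right)
    also have "\<dots> \<in> zspan C" using y by (intro zm.span_sum zm.span_scale basic_mult)
    finally show ?thesis .
  qed
  have mult: "x * y \<in> zspan C" if x: "x \<in> zspan C" and y: "y \<in> zspan C" for x y
  proof -
    have "x * y = (\<Sum>b\<in>C. zmult (zcoeff C y b) (x * b))"
      using y by (intro additive_zspan[OF _ finC indC, of "\<lambda>y. x * y"]) (simp_all add: distrib_left)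
    also have "\<dots> \<in> zspan C" using x by (intro zm.span_sum zm.span_scale mult_basic)
    finally show ?thesis .
  qed
  have zero: "zcoeff B x b = 0" if "x \<in> zspan C" "b \<in> B - C" for x b
    using that in_zspan_iff[OF C in_R[OF that(1)]] by blast
  have form: "basis_form C x y = basis_form B x y" if "x \<in> zspan C" "y \<in> zspan C" for x y
    unfolding basis_form_def zcoeff_subset[OF C that(1)] zcoeff_subset[OF C that(2)]
    by (rule sum.mono_neutral_left[OF finite_basis C]) (simp add: zero that)
  have ext: "star_extend C ?s x = star_extend B ?s x" if "x \<in> zspan C" for x
    unfolding star_extend_def zcoeff_subset[OF C that]
    by (rule sum.mono_neutral_left[OF finite_basis C]) (simp add: zero that)
  have ext_in: "star_extend C ?s x \<in> zspan C" for x
    unfolding star_extend_def by (intro zm.span_sum zm.span_scale zm.span_base star)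
  show inv: "based_involution (zspan C) C ?s"
    unfolding based_involution_def
  proof (intro conjI ballI)
    fix x y z assume xyz: "x \<in> zspan C" "y \<in> zspan C" "z \<in> zspan C"
    have "basis_form B (x * y) z = basis_form B x (z * star_extend B ?s y) \<and>
       basis_form B (x * y) z = basis_form B y (star_extend B ?s x * z)"
      using based_involution_basic_star xyz[THEN in_R] unfolding based_involution_def by blast
    then show "basis_form C (x * y) z = basis_form C x (z * star_extend C ?s y)"
      "basis_form C (x * y) z = basis_form C y (star_extend C ?s x * z)"
      using xyz mult ext_in by (simp_all add: form ext[symmetric])
  qed (use star star_star in_B in auto)
  show "based_ring (zspan C) C"
  proof
    show "\<exists>s. based_involution (zspan C) C s" using inv by blast
    show "0 \<le> zcoeff C (x * y) z" if "x \<in> C" "y \<in> C" "z \<in> C" for x y z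
      using that in_B structure_nonneg by (simp add: zcoeff_subset[OF C basic_mult])
  qed (use finC indC one mult in auto)
qed

lemma based_ring_adj: "based_ring (zspan adj) adj"
  and based_involution_adj: "based_involution (zspan adj) adj (basic_star R B)"
proof -
  have "z \<in> adj" if "x \<in> adj" "y \<in> adj" "z \<in> B" "zcoeff B (x * y) z \<noteq> 0" for x y z
    using adjoint_closure.product[OF that(1-3)] that(4) by simp
  then show "based_ring (zspan adj) adj" "based_involution (zspan adj) adj (basic_star R B)"
    using based_subring_zspan[OF adj_subset unit_in_adj star_in_adj] by blast+
qed

text \<open>
  A based subring that contains all \<open>x x\<^sup>*\<close> contains their constituents, and inductively those of
  all products, since every constituent of a member of the span of \<open>D\<close> belongs to \<open>D\<close>.
\<close>

lemma adjoint_subring_eq: "adjoint_subring R B = zspan adj"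
  unfolding adjoint_subring_def
proof (rule hull_unique)
  have "x * basic_star R B x \<in> zspan adj" if x: "x \<in> B" for x
  proof -
    have "z \<in> adj" if "z \<in> B" "zcoeff B (x * basic_star R B x) z \<noteq> 0" for z
      using adjoint_closure.square[OF x that(1)] that(2) by simp
    then show ?thesis
      using x by (simp add: in_zspan_iff[OF adj_subset] mult_closed basis_subset star_in)
  qed
  then show "{x * basic_star R B x |x. x \<in> B} \<subseteq> zspan adj" by blast
  show "based_subring B (zspan adj)"
    unfolding based_subring_def using adj_subset based_ring_adj by blast
next
  fix T assume gens: "{x * basic_star R B x |x. x \<in> B} \<subseteq> T" and "based_subring B T"
  then obtain D where D: "D \<subseteq> B" and "based_ring T D" by (auto simp: based_subring_def)
  then interpret T: based_ring T D by simp
  have T_R: "x \<in> R" if "x \<in> T" for x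
    using that zm.span_mono[OF D] T.span_basis span_basis by blast
  have support: "z \<in> D" if "x \<in> T" "z \<in> B" "zcoeff B x z \<noteq> 0" for x z
    using that in_zspan_iff[OF D T_R[OF that(1)]] T.span_basis by blast
  have "adj \<subseteq> D"
  proof
    fix z assume "z \<in> adj"
    then show "z \<in> D"
    proof induction
      case (square x z)
      then show ?case using gens by (intro support[of "x * basic_star R B x"]) auto
    next
      case (product x y z)
      then show ?case
        by (intro support[of "x * y"]) (auto intro: T.mult_closed T.basis_subset)
    qed
  qed
  then show "zspan adj \<subseteq> T" using zm.span_mono T.span_basis by blast
qed

lemma adjoint_basis_eq: "adjoint_basis R B = adj"
proof -
  have "b \<in> adj" if "b \<in> B" "b \<in> zspan adj" for b
    using in_zspan_iff[OF adj_subset basis_subset[OF that(1)]] that by (simp add: zcoeff_basic)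
  then show ?thesis
    unfolding adjoint_subring_eq using adj_subset by (auto intro: zm.span_base)
qed

lemma basic_star_adj:
  assumes "b \<in> adj"
  shows "basic_star (zspan adj) adj b = basic_star R B b"
proof -
  interpret Adj: based_ring "zspan adj" adj by (rule based_ring_adj)
  show ?thesis
    by (rule Adj.based_involution_unique[OF Adj.based_involution_basic_star based_involution_adj assms])
qed

lemma structure_constant_adj:
  assumes "x \<in> adj" "y \<in> adj"
  shows "structure_constant adj x y z = structure_constant B x y z"
proof -
  interpret Adj: based_ring "zspan adj" adj by (rule based_ring_adj)
  have "x * y \<in> zspan adj" using assms by (intro Adj.mult_closed zm.span_base)
  then show ?thesis using zcoeff_subset[OF adj_subset] by simp
qed

lemma FPdim_adj:
  assumes "b \<in> adj"
  shows "FPdim (zspan adj) adj b = FPdim R B b"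
proof -
  interpret Adj: based_ring "zspan adj" adj by (rule based_ring_adj)
  interpret F: fusion_ring adj 1 "basic_star R B" "structure_constant B" by (rule fusion_ring_adj)
  have "Adj.character (FPdim R B)"
    using character_adj[OF character_FPdim]
    by (simp add: F.character_def Adj.character_def structure_constant_adj)
  then show ?thesis using Adj.character_unique[OF Adj.character_FPdim] assms by blast
qed

lemma FPdim_ring_adjoint:
  "FPdim_ring (adjoint_subring R B) (adjoint_basis R B) = (\<Sum>b\<in>adj. (FPdim R B b)\<^sup>2)"
  unfolding FPdim_ring_def adjoint_basis_eq unfolding adjoint_subring_eq by (simp add: FPdim_adj)

end

text \<open>
  The definition unfolds the adjoint series at its end; the induction needs it unfolded at its
  start.
\<close>

lemma iterated_adjoint_Suc:
  "iterated_adjoint R B (Suc n) = iterated_adjoint (adjoint_subring R B) (adjoint_basis R B) n"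
  by (induction n) (simp_all add: case_prod_beta Let_def)

lemma iterated_adjoint_closure:
  assumes "based_ring R B" and "fst (iterated_adjoint R B n) = zspan {1}"
  shows "((\<lambda>A. adjoint_closure A (basic_star R B) (structure_constant B)) ^^ n) B = {1}"
  using assms
proof (induction n arbitrary: R B)
  case 0
  then interpret based_ring R B by simp
  have "b = 1" if b: "b \<in> B" for b
  proof -
    have "b \<in> zspan {1}" using basis_subset[OF b] 0 by simp
    then show ?thesis
      using in_zspan_iff[of "{1}" b] b one_basic by (auto simp: basis_subset zcoeff_basic)
  qed
  then show ?case using one_basic by auto
next
  case (Suc n)
  interpret based_ring R B by fact
  interpret Adj: based_ring "zspan adj" adj by (rule based_ring_adj)
  have "fst (iterated_adjoint (zspan adj) adj n) = zspan {1}"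
    using Suc.prems(2) unfolding iterated_adjoint_Suc adjoint_basis_eq unfolding adjoint_subring_eq .
  then have "((\<lambda>A. adjoint_closure A (basic_star (zspan adj) adj) (structure_constant adj)) ^^ n) adj = {1}"
    by (rule Suc.IH[OF based_ring_adj])
  moreover have "((\<lambda>A. adjoint_closure A (basic_star (zspan adj) adj) (structure_constant adj)) ^^ n) adj
    = ((\<lambda>A. adjoint_closure A (basic_star R B) (structure_constant B)) ^^ n) adj"
    by (intro funpow_adjoint_closure_cong star_in_adj basic_star_adj structure_constant_adj)
  ultimately show ?case by (simp add: funpow_Suc_right del: funpow.simps)
qed

section \<open>Based modules in coordinates\<close>

abbreviation action_constant :: "('a \<Rightarrow> 'm::ab_group_add \<Rightarrow> 'm) \<Rightarrow> 'm set \<Rightarrow> 'a \<Rightarrow> 'm \<Rightarrow> 'm \<Rightarrow> real"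
  where "action_constant act V x v w \<equiv> real_of_int (zcoeff V (act x v) w)"

context based_module
begin

lemma module_basis_subset: "v \<in> V \<Longrightarrow> v \<in> M"
  by (simp add: span_module_basis zm.span_base)

lemma zcoeff_act_left:
  assumes "x \<in> R" "m \<in> M"
  shows "zcoeff V (act x m) w = (\<Sum>b\<in>B. zcoeff B x b * zcoeff V (act b m) w)"
proof -
  have "act x m = (\<Sum>b\<in>B. zmult (zcoeff B x b) (act b m))"
    using assms span_basis act_add_left
    by (intro additive_zspan[OF _ finite_basis independent_basis]) simp_all
  moreover have "act b m \<in> zspan V" if "b \<in> B" for b
    using act_closed[OF basis_subset[OF that] assms(2)] span_module_basis by simp
  ultimately show ?thesis by (simp add: zcoeff_lincomb[OF independent_module_basis])
qed

lemma zcoeff_act_right: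
  assumes "x \<in> R" "m \<in> M"
  shows "zcoeff V (act x m) w = (\<Sum>u\<in>V. zcoeff V m u * zcoeff V (act x u) w)"
proof -
  have "act x m = (\<Sum>u\<in>V. zmult (zcoeff V m u) (act x u))"
    using assms span_module_basis act_add_right
    by (intro additive_zspan[OF _ finite_module_basis independent_module_basis]) simp_all
  moreover have "act x u \<in> zspan V" if "u \<in> V" for u
    using act_closed[OF assms(1) module_basis_subset[OF that]] span_module_basis by simp
  ultimately show ?thesis by (simp add: zcoeff_lincomb[OF independent_module_basis])
qed

lemma fusion_module_action:
  "fusion_module B 1 (basic_star R B) (structure_constant B) V (action_constant act V)"
proof
  fix x y v w assume B: "x \<in> B" "y \<in> B" and V: "v \<in> V" "w \<in> V"
  note R = B[THEN basis_subset] and M = V[THEN module_basis_subset]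
  have "(\<Sum>z\<in>B. zcoeff B (x * y) z * zcoeff V (act z v) w) = zcoeff V (act (x * y) v) w"
    using R M by (simp add: zcoeff_act_left[of "x * y"] mult_closed)
  also have "\<dots> = (\<Sum>u\<in>V. zcoeff V (act y v) u * zcoeff V (act x u) w)"
    using R M by (simp add: act_mult act_closed zcoeff_act_right[of x "act y v"])
  finally have "real_of_int (\<Sum>z\<in>B. zcoeff B (x * y) z * zcoeff V (act z v) w)
    = real_of_int (\<Sum>u\<in>V. zcoeff V (act y v) u * zcoeff V (act x u) w)" by simp
  then show "(\<Sum>z\<in>B. structure_constant B x y z * action_constant act V z v w)
    = (\<Sum>u\<in>V. action_constant act V y v u * action_constant act V x u w)" by simp
next
  fix v w assume "v \<in> V" "w \<in> V"
  then show "action_constant act V 1 v w = (if v = w then 1 else 0)"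
    using zm.representation_basis[OF independent_module_basis, of v]
    by (auto simp: act_one module_basis_subset)
qed (use finite_module_basis act_nonneg act_star in auto)

sublocale Mod: fusion_module B 1 "basic_star R B" "structure_constant B" V "action_constant act V"
  by (rule fusion_module_action)

lemma FP_eigenvector_iff:
  "FP_eigenvector R B act V \<mu> \<longleftrightarrow> Mod.eigenvector (FPdim R B) \<mu>"
proof
  assume "FP_eigenvector R B act V \<mu>"
  then show "Mod.eigenvector (FPdim R B) \<mu>"
    by (simp add: FP_eigenvector_def Mod.eigenvector_def basis_subset)
next
  assume mu: "Mod.eigenvector (FPdim R B) \<mu>"
  have "(\<Sum>v\<in>V. action_constant act V x v w * \<mu> v) = FPdim R B x * \<mu> w"
    if x: "x \<in> R" and w: "w \<in> V" for x w
  proof -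
    have "(\<Sum>v\<in>V. action_constant act V x v w * \<mu> v)
      = (\<Sum>v\<in>V. \<Sum>b\<in>B. real_of_int (zcoeff B x b) * (action_constant act V b v w * \<mu> v))"
      using x by (intro sum.cong refl)
        (simp add: zcoeff_act_left module_basis_subset sum_distrib_right mult.assoc)
    also have "\<dots> = (\<Sum>b\<in>B. real_of_int (zcoeff B x b) * (\<Sum>v\<in>V. action_constant act V b v w * \<mu> v))"
      by (subst sum.swap) (simp add: sum_distrib_left)
    also have "\<dots> = (\<Sum>b\<in>B. real_of_int (zcoeff B x b) * FPdim R B b) * \<mu> w"
      using mu w by (simp add: Mod.eigenvector_def sum_distrib_right mult.assoc)
    finally show ?thesis by (simp add: FPdim_expansion[OF x])
  qed
  then show "FP_eigenvector R B act V \<mu>"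
    using mu by (simp add: FP_eigenvector_def Mod.eigenvector_def)
qed

lemma based_submodule_zspan:
  assumes W: "W \<subseteq> V"
    and closed: "\<And>x u w. x \<in> B \<Longrightarrow> u \<in> W \<Longrightarrow> w \<in> V \<Longrightarrow> zcoeff V (act x u) w \<noteq> 0 \<Longrightarrow> w \<in> W"
  shows "based_submodule R act V (zspan W)"
  unfolding based_submodule_def
proof (intro conjI ballI)
  show "\<exists>U\<subseteq>V. zspan W = zspan U" using W by blast
  fix x m assume x: "x \<in> R" and m: "m \<in> zspan W"
  have mM: "m \<in> M" using m zm.span_mono[OF W] span_module_basis by blast
  have m0: "zcoeff V m u = 0" if "u \<in> V - W" for u
    using that zm.representation_ne_zero zm.representation_extend[OF independent_module_basis m W]
    by (metis DiffD2)
  have coeff: "w \<in> W" if w: "w \<in> V" and nz: "zcoeff V (act x m) w \<noteq> 0" for w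
  proof -
    obtain u where u: "u \<in> V" "zcoeff V m u * zcoeff V (act x u) w \<noteq> 0"
      using nz unfolding zcoeff_act_right[OF x mM] by (rule sum.not_neutral_contains_not_neutral)
    then have "u \<in> W" and "zcoeff V (act x u) w \<noteq> 0" using m0 by auto
    from this(2) obtain b where "b \<in> B" "zcoeff B x b * zcoeff V (act b u) w \<noteq> 0"
      unfolding zcoeff_act_left[OF x module_basis_subset[OF u(1)]]
      by (rule sum.not_neutral_contains_not_neutral)
    then show ?thesis using closed[of b u w] \<open>u \<in> W\<close> w by simp
  qed
  have "act x m = (\<Sum>w\<in>V. zmult (zcoeff V (act x m) w) w)"
    using zm.sum_representation_eq[OF independent_module_basis _ finite_module_basis order_refl]
      act_closed[OF x mM] span_module_basis by simp
  moreover have "zmult (zcoeff V (act x m) w) w \<in> zspan W" if "w \<in> V" for w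
    using coeff[OF that] by (cases "zcoeff V (act x m) w = 0")
      (auto intro: zm.span_zero zm.span_scale zm.span_base)
  then have "(\<Sum>w\<in>V. zmult (zcoeff V (act x m) w) w) \<in> zspan W" by (rule zm.span_sum)
  ultimately show "act x m \<in> zspan W" by simp
qed

text \<open>
  An orbit and its complement both span submodules, the complement because orbits are closed under
  the action in both directions.  So an indecomposable module has a single orbit.
\<close>

lemma indecomposable_orbit:
  assumes ind: "indecomposable_based_module R B act M V" and v: "v \<in> V"
  shows "Mod.orbit v = V"
proof (rule ccontr)
  assume "Mod.orbit v \<noteq> V"
  define W U where "W = Mod.orbit v" and "U = V - Mod.orbit v"
  have WV: "W \<subseteq> V" and UV: "U \<subseteq> V" and WU: "W \<union> U = V"
    using Mod.orbit_subset by (auto simp: W_def U_def)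
  have nz: "zspan S \<noteq> {0}" if "S \<subseteq> V" "u \<in> S" for S u
  proof -
    have "u \<noteq> 0" using that zm.dependent_zero independent_module_basis by blast
    then show ?thesis using zm.span_base[OF that(2)] by blast
  qed
  have "based_submodule R act V (zspan W)"
    using Mod.orbit_closed[OF v] by (intro based_submodule_zspan WV) (auto simp: W_def)
  moreover have "based_submodule R act V (zspan U)"
    using Mod.orbit_closed_back[OF v] by (intro based_submodule_zspan UV) (auto simp: U_def)
  moreover have "zspan W \<noteq> {0}" using nz[OF WV] Mod.orbit_refl[OF v] by (auto simp: W_def)
  moreover have "zspan U \<noteq> {0}"
    using nz[OF UV] \<open>Mod.orbit v \<noteq> V\<close> Mod.orbit_subset by (auto simp: U_def)
  moreover have "zspan W \<inter> zspan U = {0}"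
  proof -
    have "m = 0" if W: "m \<in> zspan W" and U: "m \<in> zspan U" for m
    proof -
      have "zcoeff V m u = 0" for u
        using zm.representation_ne_zero[of W m u] zm.representation_ne_zero[of U m u]
          zm.representation_extend[OF independent_module_basis W WV]
          zm.representation_extend[OF independent_module_basis U UV]
        by (auto simp: W_def U_def)
      moreover have "m \<in> zspan V" using W zm.span_mono[OF WV] by blast
      ultimately show ?thesis
        using zm.sum_representation_eq[OF independent_module_basis _ finite_module_basis order_refl, of m]
        by simp
    qed
    then show ?thesis using zm.span_zero by blast
  qed
  moreover have "M = {n + p |n p. n \<in> zspan W \<and> p \<in> zspan U}"
    using zm.span_Un[of W U] WU span_module_basis by simp
  ultimately show False using ind unfolding indecomposable_based_module_def by blast
qed

lemma eigenvector_FPdim_basic: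
  assumes "indecomposable_based_module R B act M V" "v \<in> V"
  shows "Mod.eigenvector (FPdim R B) (FPdim_basic R B act V)"
proof -
  have "\<exists>\<mu>. FP_eigenvector R B act V \<mu>"
    using Mod.eigenvector_exists[OF character_FPdim assms(2) indecomposable_orbit[OF assms]]
    by (simp add: FP_eigenvector_iff)
  then have "FP_eigenvector R B act V (FPdim_basic R B act V)"
    unfolding FPdim_basic_def by (rule someI_ex)
  then show ?thesis by (simp add: FP_eigenvector_iff)
qed

end

section \<open>Integrality\<close>

theorem theorem5p2:
  fixes R B :: "'a::ring_1 set"
  assumes "nilpotent_based_ring R B"
  shows "(\<forall>(act :: 'a \<Rightarrow> 'm::ab_group_add \<Rightarrow> 'm) M V v.
            indecomposable_based_module R B act M V \<longrightarrow> v \<in> V \<longrightarrow>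
            FPdim_module R B act V / (FPdim_basic R B act V v)\<^sup>2 \<in> \<int>) \<and>
         (\<forall>x\<in>B. FPdim_ring (adjoint_subring R B) (adjoint_basis R B) / (FPdim R B x)\<^sup>2 \<in> \<int>)"
proof -
  obtain n where "based_ring R B" and "fst (iterated_adjoint R B n) = zspan {1}"
    using assms by (auto simp: nilpotent_based_ring_def)
  then have nil: "((\<lambda>A. adjoint_closure A (basic_star R B) (structure_constant B)) ^^ n) B = {1}"
    by (rule iterated_adjoint_closure)
  interpret based_ring R B by fact
  show ?thesis
  proof (intro conjI allI impI ballI)
    fix act :: "'a \<Rightarrow> 'm \<Rightarrow> 'm" and M V v
    assume ind: "indecomposable_based_module R B act M V" and v: "v \<in> V"
    then interpret based_module R B act M V by (simp add: indecomposable_based_module_def)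
    show "FPdim_module R B act V / (FPdim_basic R B act V v)\<^sup>2 \<in> \<int>"
      unfolding FPdim_module_def
      by (rule nilpotent_norm_quotient_integral[OF nil fusion_module_action character_FPdim
            eigenvector_FPdim_basic[OF ind v] v indecomposable_orbit[OF ind v]])
  next
    fix x assume "x \<in> B"
    then show "FPdim_ring (adjoint_subring R B) (adjoint_basis R B) / (FPdim R B x)\<^sup>2 \<in> \<int>"
      unfolding FPdim_ring_adjoint
      by (rule nilpotent_adj_norm_quotient_integral[OF nil character_FPdim])
  qed
qed

end
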